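(* Let $m\ge2$, $\omega\in\mathcal{M}_m$, and consider the degenerate action of weight $m$ of $\mathcal{H}_1$ on $\mathcal{A}$ associated to $\omega$. Then $$\tau(h_{(1)}(a^0),h_{(2)}(a^1))=\delta(h)\,\tau(a^0,a^1),\qquad\forall\,h\in\mathcal{H}_1,\ a^0,a^1\in\mathcal{A},$$ for $\tau=\tau_{m-2}$ and for $\tau=\widetilde\tau_{m-2}$.
   Context: **The Hopf algebra $\mathcal{H}_1$.** As an algebra, $\mathcal{H}_1$ is the universal enveloping algebra (over $\mathbb{C}$) of the Lie algebra with basis $\{X,Y,\delta_n;\ n\ge1\}$ and brackets $[Y,X]=X$, $[Y,\delta_n]=n\delta_n$, $[X,\delta_n]=\delta_{n+1}$, $[\delta_k,\delta_\ell]=0$. The coproduct is the algebra homomorphism determined by $\Delta Y=Y\otimes1+1\otimes Y$, $\Delta\delta_1=\delta_1\otimes1+1\otimes\delta_1$, $\Delta X=X\otimes1+1\otimes X+\delta_1\otimes Y$; $\Delta h=h_{(1)}\otimes h_{(2)}$. The character $\delta$ of $\mathcal{H}_1$ is given by $\delta(Y)=1$, $\delta(X)=0$, $\delta(\delta_n)=0$. **The algebra $\mathcal{A}$.** $\mathcal{M}=\bigoplus_k\mathcal{M}_k$ is the graded algebra of holomorphic modular forms of all levels, $\mathcal{M}_k=\bigcup_N\mathcal{M}_k(\Gamma(N))$; $w$ denotes weight. $(f|\gamma)(z)=\det(\gamma)^{k/2}(cz+d)^{-k}f(\gamma z)$ for $f$ of weight $k$, $\gamma\in\mathrm{GL}^+(2,\mathbb{Q})$.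 $\mathcal{A}=\mathcal{M}\ltimes\mathrm{GL}^+(2,\mathbb{Q})$: finite sums $\sum f_\gamma U_\gamma$, product $(fU_\alpha)(gU_\beta)=f\cdot(g|\alpha^{-1})U_{\alpha\beta}$. **Degenerate action** associated to $\omega\in\mathcal{M}_m$: the Hopf action of $\mathcal{H}_1$ on $\mathcal{A}$ determined by letting $Y,X,\delta_1$ act as $\tilde Y(a)=\frac{w(a)}m a$ ($a$ homogeneous), $\tilde X(a)=\omega\tilde Y(a)$, $\tilde\delta_1(a)=[\omega,a]=\omega a-a\omega$. **The cocycles.** $W_n$ is the space of homogeneous polynomials of degree $n$ in $\mathbb{C}[T_1,T_2]$ with $\mathrm{GL}^+(2,\mathbb{R})$-action $(g\cdot P)(T_1,T_2)=\det(g)^{-n/2}P(aT_1+cT_2,bT_1+dT_2)$, $g=\begin{pmatrix}a&b\\c&d\end{pmatrix}$. Put $F(z)=F_{m-2}(z)=(zT_1+T_2)^{m-2}$ and $\check F(z_0)=\int_0^{z_0}F(z)dz$. For a modular form $f$ of level $N$, $f=\sum_{n\ge0}a_ne^{2\pi inz/N}$, let $\mathbf{a}_0(f)=a_0$, $\widetilde f=f-a_0$. Fix $z_0\in\mathbb{H}$. The bilinear maps $\tau_{m-2},\widetilde\tau_{m-2}:\mathcal{A}\times\mathcal{A}\to W_{m-2}$ vanish on $(f^0U_{\gamma_0},f^1U_{\gamma_1})$ unless $w(f^0)+w(f^1)=m$ and $\gamma_0\gamma_1=1$, in which case, with $g=f^0\cdot(f^1|\gamma_1)$ (so $g|\gamma_0=(f^0|\gamma_0)f^1$),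 $$\tau_{m-2}(f^0U_{\gamma_0},f^1U_{\gamma_1})=\int_{z_0}^{\gamma_0z_0}F\,g\,dz,$$ $$\widetilde\tau_{m-2}(f^0U_{\gamma_0},f^1U_{\gamma_1})=\int_{z_0}^{\gamma_0z_0}F\,g\,dz+\check F(z_0)\mathbf{a}_0(g)-\gamma_0\cdot\check F(z_0)\,\mathbf{a}_0(g|\gamma_0)-\int_{z_0}^{i\infty}F\,\widetilde g\,dz+\int_{z_0}^{i\infty}\gamma_0\cdot F\;\widetilde{g|\gamma_0}\,dz.$$ *)

theory Defs
  imports
    "HOL-Complex_Analysis.Complex_Analysis"
    "HOL-Library.Poly_Mapping"
    "HOL-Library.Function_Algebras"
begin

section \<open>Finitely supported functions\<close>

definition pconst :: "'b \<Rightarrow> ('a::zero \<Rightarrow>\<^sub>0 'b::zero)" where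
  "pconst c = Poly_Mapping.single 0 c"

lemma poly_mapping_single_induct [case_names zero single_add]:
  fixes p :: "'a \<Rightarrow>\<^sub>0 'b::comm_monoid_add"
  assumes zero: "P 0"
    and add: "\<And>k c p. P p \<Longrightarrow> P (Poly_Mapping.single k c + p)"
  shows "P p"
proof (induction p rule: update_induct)
  case const
  show ?case by (rule zero)
next
  case (update p a b)
  have "Poly_Mapping.update a b p = Poly_Mapping.single a b + p"
    using update(1)
    by (intro poly_mapping_eqI)
       (auto simp: lookup_update lookup_add lookup_single in_keys_iff when_def)
  then show ?case using add[OF update(3)] by simp
qed

text \<open>The extension of a family of maps \<open>F k\<close> to finite sums of terms concentrated at \<open>k\<close>.\<close>

definition pm_extend :: "('k \<Rightarrow> 'b \<Rightarrow> 'v) \<Rightarrow> ('k \<Rightarrow>\<^sub>0 'b::zero) \<Rightarrow> 'v::comm_monoid_add" where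
  "pm_extend F p = (\<Sum>k\<in>Poly_Mapping.keys p. F k (Poly_Mapping.lookup p k))"

lemma pm_extend_zero [simp]: "pm_extend F 0 = 0"
  by (simp add: pm_extend_def)

lemma pm_extend_superset:
  assumes "finite S" "Poly_Mapping.keys p \<subseteq> S" "\<And>k. F k 0 = 0"
  shows "pm_extend F p = (\<Sum>k\<in>S. F k (Poly_Mapping.lookup p k))"
  unfolding pm_extend_def using assms
  by (intro sum.mono_neutral_left) (auto simp: in_keys_iff)

lemma pm_extend_single:
  assumes "\<And>k. F k 0 = 0"
  shows "pm_extend F (Poly_Mapping.single k c) = F k c"
  using assms by (simp add: pm_extend_def)

lemma pm_extend_add:
  assumes "\<And>k. F k 0 = 0" "\<And>k x y. F k (x + y) = F k x + F k y"
  shows "pm_extend F (p + q) = pm_extend F p + pm_extend F q"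
proof -
  let ?S = "Poly_Mapping.keys p \<union> Poly_Mapping.keys q"
  have "pm_extend F (p + q) = (\<Sum>k\<in>?S. F k (Poly_Mapping.lookup (p + q) k))"
    by (rule pm_extend_superset) (use assms keys_add[of p q] in auto)
  also have "\<dots> = (\<Sum>k\<in>?S. F k (Poly_Mapping.lookup p k)) + (\<Sum>k\<in>?S. F k (Poly_Mapping.lookup q k))"
    by (simp add: lookup_add assms sum.distrib)
  also have "\<dots> = pm_extend F p + pm_extend F q"
    by (simp add: pm_extend_superset[of ?S] assms)
  finally show ?thesis .
qed


section \<open>Algebras given by generators and relations\<close>

inductive_set two_sided_ideal :: "'a::ring_1 set \<Rightarrow> 'a set" for R where
  ideal_zero: "0 \<in> two_sided_ideal R"
| ideal_add: "\<lbrakk>x \<in> two_sided_ideal R; y \<in> two_sided_ideal R\<rbrakk> \<Longrightarrow> x + y \<in> two_sided_ideal R"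
| ideal_gen: "r \<in> R \<Longrightarrow> a * r * b \<in> two_sided_ideal R"

lemma ideal_mult_left: "x \<in> two_sided_ideal R \<Longrightarrow> c * x \<in> two_sided_ideal R"
  by (induction rule: two_sided_ideal.induct)
     (auto simp: distrib_left mult.assoc[symmetric] intro: two_sided_ideal.intros)

lemma ideal_mult_right: "x \<in> two_sided_ideal R \<Longrightarrow> x * c \<in> two_sided_ideal R"
proof (induction rule: two_sided_ideal.induct)
  case (ideal_gen r a b)
  then show ?case using two_sided_ideal.ideal_gen[of r R a "b * c"] by (simp add: mult.assoc)
qed (auto simp: distrib_right intro: two_sided_ideal.intros)

lemma ideal_uminus: "x \<in> two_sided_ideal R \<Longrightarrow> - x \<in> two_sided_ideal R"
  using ideal_mult_left[of x R "- 1"] by simp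

lemma ideal_base: "r \<in> R \<Longrightarrow> r \<in> two_sided_ideal R"
  using ideal_gen[of r R 1 1] by simp

definition ideal_cong :: "'a::ring_1 set \<Rightarrow> 'a \<Rightarrow> 'a \<Rightarrow> bool" where
  "ideal_cong R x y \<longleftrightarrow> x - y \<in> two_sided_ideal R"

lemma equivp_ideal_cong: "equivp (ideal_cong R)"
proof (rule equivpI)
  show "reflp (ideal_cong R)" by (auto simp: reflp_def ideal_cong_def ideal_zero)
  show "symp (ideal_cong R)"
    using ideal_uminus by (fastforce simp: symp_def ideal_cong_def)
  show "transp (ideal_cong R)"
    unfolding transp_def ideal_cong_def
  proof (intro allI impI)
    fix x y z assume "x - y \<in> two_sided_ideal R" "y - z \<in> two_sided_ideal R"
    from ideal_add[OF this] show "x - z \<in> two_sided_ideal R" by simp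
  qed
qed

lemma ideal_cong_refl: "ideal_cong R x x"
  by (simp add: ideal_cong_def ideal_zero)

lemma ideal_cong_add:
  assumes "ideal_cong R a b" "ideal_cong R c d"
  shows "ideal_cong R (a + c) (b + d)"
  using ideal_add[of "a - b" R "c - d"] assms by (simp add: ideal_cong_def algebra_simps)

lemma ideal_cong_uminus: "ideal_cong R a b \<Longrightarrow> ideal_cong R (- a) (- b)"
  using ideal_uminus[of "a - b" R] by (simp add: ideal_cong_def algebra_simps)

lemma ideal_cong_diff:
  assumes "ideal_cong R a b" "ideal_cong R c d"
  shows "ideal_cong R (a - c) (b - d)"
  using ideal_cong_add[OF assms(1) ideal_cong_uminus[OF assms(2)]] by simp

lemma ideal_cong_mult:
  assumes "ideal_cong R a b" "ideal_cong R c d"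
  shows "ideal_cong R (a * c) (b * d)"
proof -
  have "a * c - b * d = (a - b) * c + b * (c - d)" by (simp add: algebra_simps)
  then show ?thesis
    using assms by (simp add: ideal_cong_def ideal_add ideal_mult_left ideal_mult_right)
qed

definition commutator :: "'a::ring \<Rightarrow> 'a \<Rightarrow> 'a" where
  "commutator a b = a * b - b * a"

text \<open>The free monoid, written additively so that \<open>'g free_monoid \<Rightarrow>\<^sub>0 complex\<close> with the
  convolution product of \<^typ>\<open>'a \<Rightarrow>\<^sub>0 'b\<close> is the free associative algebra.\<close>

datatype 'g free_monoid = Word (letters: "'g list")

instantiation free_monoid :: (type) monoid_add
begin
definition "0 = Word []"
definition "u + v = Word (letters u @ letters v)"
instance
  by standard (auto simp: zero_free_monoid_def plus_free_monoid_def)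
end

text \<open>Linear extension to the monoid algebra of a monoid acting by \<open>\<rho>\<close>.\<close>

definition monoid_act ::
    "(complex \<Rightarrow> 'v \<Rightarrow> 'v) \<Rightarrow> ('m \<Rightarrow> 'v \<Rightarrow> 'v) \<Rightarrow> ('m \<Rightarrow>\<^sub>0 complex) \<Rightarrow> 'v \<Rightarrow> 'v::ab_group_add" where
  "monoid_act s \<rho> p v = pm_extend (\<lambda>w c. s c (\<rho> w v)) p"

lemma monoid_act_zero [simp]: "monoid_act s \<rho> 0 v = 0"
  by (simp add: monoid_act_def)

context
  fixes s :: "complex \<Rightarrow> 'v \<Rightarrow> 'v::ab_group_add"
  assumes s: "module s"
begin

interpretation module s by (rule s)

lemma monoid_act_add: "monoid_act s \<rho> (p + q) v = monoid_act s \<rho> p v + monoid_act s \<rho> q v"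
  unfolding monoid_act_def by (rule pm_extend_add) (auto simp: scale_left_distrib)

lemma monoid_act_single: "monoid_act s \<rho> (Poly_Mapping.single w c) v = s c (\<rho> w v)"
  unfolding monoid_act_def by (rule pm_extend_single) auto

lemma monoid_act_uminus: "monoid_act s \<rho> (- p) v = - monoid_act s \<rho> p v"
  using monoid_act_add[of \<rho> "- p" p v] by (simp add: eq_neg_iff_add_eq_0)

lemma monoid_act_diff: "monoid_act s \<rho> (p - q) v = monoid_act s \<rho> p v - monoid_act s \<rho> q v"
  using monoid_act_add[of \<rho> p "- q" v] by (simp add: monoid_act_uminus)

lemma monoid_act_linear:
  assumes "\<And>w. module_hom s s (\<rho> w)"
  shows "module_hom s s (monoid_act s \<rho> p)"
proof (rule module_hom.intro[OF s s], unfold_locales)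
  fix v v' r
  show "monoid_act s \<rho> p (v + v') = monoid_act s \<rho> p v + monoid_act s \<rho> p v'"
    by (simp add: monoid_act_def pm_extend_def module_hom.add[OF assms] scale_right_distrib sum.distrib)
  show "monoid_act s \<rho> p (s r v) = s r (monoid_act s \<rho> p v)"
    by (simp add: monoid_act_def pm_extend_def module_hom.scale[OF assms] scale_sum_right mult.commute)
qed

lemma monoid_act_mult:
  fixes \<rho> :: "'m::monoid_add \<Rightarrow> 'v \<Rightarrow> 'v"
  assumes lin: "\<And>w. module_hom s s (\<rho> w)" and mon: "\<And>u w v. \<rho> (u + w) v = \<rho> u (\<rho> w v)"
  shows "monoid_act s \<rho> (p * q) v = monoid_act s \<rho> p (monoid_act s \<rho> q v)"
proof (induction p rule: poly_mapping_single_induct)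
  case zero
  show ?case by simp
next
  case (single_add u c p)
  have "monoid_act s \<rho> (Poly_Mapping.single u c * q) v = s c (\<rho> u (monoid_act s \<rho> q v))"
  proof (induction q rule: poly_mapping_single_induct)
    case zero
    show ?case by (simp add: module_hom.zero[OF lin])
  next
    case (single_add w d q)
    then show ?case
      by (simp add: distrib_left monoid_act_add mult_single monoid_act_single mon
          module_hom.add[OF lin] module_hom.scale[OF lin] scale_right_distrib)
  qed
  then show ?case
    using single_add by (simp add: distrib_right monoid_act_add monoid_act_single)
qed

lemma monoid_act_ideal:
  fixes \<rho> :: "'m::monoid_add \<Rightarrow> 'v \<Rightarrow> 'v"
  assumes lin: "\<And>w. module_hom s s (\<rho> w)" and mon: "\<And>u w v. \<rho> (u + w) v = \<rho> u (\<rho> w v)"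
    and rel: "\<And>r v. r \<in> R \<Longrightarrow> monoid_act s \<rho> r v = 0"
    and p: "p \<in> two_sided_ideal R"
  shows "monoid_act s \<rho> p v = 0"
  using p
proof induction
  case (ideal_gen r a b)
  then show ?case
    by (simp add: monoid_act_mult[OF lin mon] rel module_hom.zero[OF monoid_act_linear[OF lin]])
qed (auto simp: monoid_act_add)

end


section \<open>The algebra \<open>H\<^sub>1\<close>\<close>

text \<open>The constructor \<open>genD n\<close> is the basis element \<open>\<delta>\<^bsub>n+1\<^esub>\<close>.\<close>

datatype h1_gen = genX | genY | genD nat

type_synonym h1_free = "h1_gen free_monoid \<Rightarrow>\<^sub>0 complex"

definition free_gen :: "'g \<Rightarrow> ('g free_monoid \<Rightarrow>\<^sub>0 complex)" where
  "free_gen x = Poly_Mapping.single (Word [x]) 1"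

text \<open>The enveloping algebra of a Lie algebra with a given basis is the free algebra on the basis
  modulo \<open>xy - yx = [x, y]\<close> for basis elements \<open>x, y\<close>; by antisymmetry one relation for each
  unordered pair suffices.\<close>

definition h1_relations :: "h1_free set" where
  "h1_relations =
     {commutator (free_gen genY) (free_gen genX) - free_gen genX} \<union>
     (\<Union>n. {commutator (free_gen genY) (free_gen (genD n)) - of_nat (n + 1) * free_gen (genD n)}) \<union>
     (\<Union>n. {commutator (free_gen genX) (free_gen (genD n)) - free_gen (genD (Suc n))}) \<union>
     (\<Union>k l. {commutator (free_gen (genD k)) (free_gen (genD l))})"

quotient_type h1 = h1_free / "ideal_cong h1_relations"
  by (rule equivp_ideal_cong)

definition free_counit :: "('g free_monoid \<Rightarrow>\<^sub>0 complex) \<Rightarrow> complex" where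
  "free_counit p = Poly_Mapping.lookup p 0"

lemma module_complex: "module ((*) :: complex \<Rightarrow> complex \<Rightarrow> complex)"
  by unfold_locales (auto simp: algebra_simps)

lemma free_counit_eq:
  "free_counit p = monoid_act (*) (\<lambda>w z. if w = 0 then z else 0) p 1"
proof (induction p rule: poly_mapping_single_induct)
  case zero
  show ?case by (simp add: free_counit_def)
next
  case (single_add k c p)
  then show ?case
    by (auto simp: free_counit_def lookup_add lookup_single when_def
        monoid_act_add[OF module_complex] monoid_act_single[OF module_complex])
qed

lemma free_monoid_sum_zero_iff: "u + w = (0 :: 'g free_monoid) \<longleftrightarrow> u = 0 \<and> w = 0"
  by (cases u; cases w) (auto simp: plus_free_monoid_def zero_free_monoid_def)

lemma module_hom_counit: "module_hom (*) (*) (\<lambda>z::complex. if P then z else 0)"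
  by (intro module_hom.intro module_complex) (unfold_locales, auto)

lemma monoid_act_counit_relation:
  assumes "r \<in> h1_relations"
  shows "monoid_act (*) (\<lambda>w z. if w = 0 then z else 0) r v = (0::complex)"
proof -
  have *: "Word [x] \<noteq> 0" "Word [x] + w \<noteq> 0" for x :: h1_gen and w
    by (cases w; simp add: plus_free_monoid_def zero_free_monoid_def)+
  show ?thesis
    using assms
    by (auto simp: h1_relations_def commutator_def free_gen_def mult_single * of_nat_single
        monoid_act_diff[OF module_complex] monoid_act_single[OF module_complex])
qed

lemma free_counit_cong:
  assumes "ideal_cong h1_relations p q"
  shows "free_counit p = free_counit q"
proof -
  have "monoid_act (*) (\<lambda>w z. if w = 0 then z else 0) (p - q) (1::complex) = 0"
    by (rule monoid_act_ideal[OF module_complex module_hom_counit _ monoid_act_counit_relation])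
       (use assms in \<open>auto simp: ideal_cong_def free_monoid_sum_zero_iff\<close>)
  then show ?thesis
    by (simp add: free_counit_eq monoid_act_diff[OF module_complex])
qed

instantiation h1 :: ring_1
begin
lift_definition zero_h1 :: h1 is 0 .
lift_definition one_h1 :: h1 is 1 .
lift_definition plus_h1 :: "h1 \<Rightarrow> h1 \<Rightarrow> h1" is "(+)" by (rule ideal_cong_add)
lift_definition minus_h1 :: "h1 \<Rightarrow> h1 \<Rightarrow> h1" is "(-)" by (rule ideal_cong_diff)
lift_definition uminus_h1 :: "h1 \<Rightarrow> h1" is uminus by (rule ideal_cong_uminus)
lift_definition times_h1 :: "h1 \<Rightarrow> h1 \<Rightarrow> h1" is "(*)" by (rule ideal_cong_mult)
instance
proof
  show "0 \<noteq> (1::h1)"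
    by transfer (use free_counit_cong[of 0 1] in \<open>auto simp: free_counit_def lookup_one\<close>)
qed (transfer; simp add: algebra_simps ideal_cong_refl)+
end

lift_definition h1_counit :: "h1 \<Rightarrow> complex" is free_counit
  by (rule free_counit_cong)

lift_definition h1_const :: "complex \<Rightarrow> h1" is pconst .
lift_definition h1_gen :: "h1_gen \<Rightarrow> h1" is free_gen .

text \<open>The \<open>H\<^sub>1\<close>-module structure on a vector space with scalar multiplication \<open>s\<close> in which the
  generators act by the operators \<open>ops\<close>.\<close>

definition free_act ::
    "(complex \<Rightarrow> 'v \<Rightarrow> 'v) \<Rightarrow> (h1_gen \<Rightarrow> 'v \<Rightarrow> 'v) \<Rightarrow> h1_free \<Rightarrow> 'v \<Rightarrow> 'v::ab_group_add" where
  "free_act s ops = monoid_act s (\<lambda>w. foldr ops (letters w))"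

definition h1_act ::
    "(complex \<Rightarrow> 'v \<Rightarrow> 'v) \<Rightarrow> (h1_gen \<Rightarrow> 'v \<Rightarrow> 'v) \<Rightarrow> h1 \<Rightarrow> 'v \<Rightarrow> 'v::ab_group_add" where
  "h1_act s ops h = free_act s ops (rep_h1 h)"

text \<open>Under this condition \<^const>\<open>h1_act\<close> does not depend on the chosen representative.\<close>

definition h1_module :: "(complex \<Rightarrow> 'v \<Rightarrow> 'v) \<Rightarrow> (h1_gen \<Rightarrow> 'v \<Rightarrow> 'v::ab_group_add) \<Rightarrow> bool" where
  "h1_module s ops \<longleftrightarrow> module s \<and> (\<forall>g. module_hom s s (ops g)) \<and>
     (\<forall>v. ops genY (ops genX v) - ops genX (ops genY v) = ops genX v) \<and>
     (\<forall>n v. ops genY (ops (genD n) v) - ops (genD n) (ops genY v) = s (of_nat (n + 1)) (ops (genD n) v)) \<and>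
     (\<forall>n v. ops genX (ops (genD n) v) - ops (genD n) (ops genX v) = ops (genD (Suc n)) v) \<and>
     (\<forall>k l v. ops (genD k) (ops (genD l) v) = ops (genD l) (ops (genD k) v))"

context
  fixes s :: "complex \<Rightarrow> 'v \<Rightarrow> 'v::ab_group_add" and ops :: "h1_gen \<Rightarrow> 'v \<Rightarrow> 'v"
  assumes mod: "h1_module s ops"
begin

interpretation module s using mod by (simp add: h1_module_def)

lemma module_s: "module s" by (rule module_axioms)

lemma module_hom_ops: "module_hom s s (foldr ops w)"
proof (induction w)
  case Nil
  show ?case by (simp add: id_def module_hom_ident)
next
  case (Cons g w)
  have "module_hom s s (ops g)" using mod by (simp add: h1_module_def)
  from module_hom_compose[OF Cons this] show ?case by (simp add: comp_def)
qed

lemma foldr_letters_add: "foldr ops (letters (u + w)) v = foldr ops (letters u) (foldr ops (letters w) v)"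
  by (simp add: plus_free_monoid_def)

lemma free_act_relation:
  assumes "r \<in> h1_relations"
  shows "free_act s ops r v = 0"
  using assms mod
  by (auto simp: free_act_def h1_relations_def commutator_def free_gen_def mult_single
      of_nat_single plus_free_monoid_def zero_free_monoid_def h1_module_def
      monoid_act_diff[OF module_s] monoid_act_single[OF module_s])

lemma free_act_cong:
  assumes "ideal_cong h1_relations p q"
  shows "free_act s ops p v = free_act s ops q v"
proof -
  have "free_act s ops (p - q) v = 0"
    unfolding free_act_def
    by (rule monoid_act_ideal[OF module_s module_hom_ops foldr_letters_add])
       (use assms free_act_relation in \<open>auto simp: ideal_cong_def free_act_def\<close>)
  then show ?thesis by (simp add: free_act_def monoid_act_diff[OF module_s])
qed

lemma h1_act_abs: "h1_act s ops (abs_h1 p) v = free_act s ops p v"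
  unfolding h1_act_def
  by (rule free_act_cong, rule Quotient3_rep_abs[OF Quotient3_h1])
     (rule ideal_cong_refl)

lemma h1_act_add: "h1_act s ops (h + k) v = h1_act s ops h v + h1_act s ops k v"
  by (induction h; induction k)
     (simp add: plus_h1.abs_eq h1_act_abs free_act_def monoid_act_add[OF module_s])

lemma h1_act_mult: "h1_act s ops (h * k) v = h1_act s ops h (h1_act s ops k v)"
  by (induction h; induction k)
     (simp add: times_h1.abs_eq h1_act_abs free_act_def
       monoid_act_mult[OF module_s module_hom_ops foldr_letters_add])

lemma h1_act_const: "h1_act s ops (h1_const c) v = s c v"
  by (simp add: h1_const.abs_eq h1_act_abs free_act_def pconst_def monoid_act_single[OF module_s]
      zero_free_monoid_def)

lemma h1_act_one: "h1_act s ops 1 v = v"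
  by (simp add: one_h1.abs_eq h1_act_abs free_act_def monoid_act_single[OF module_s]
      zero_free_monoid_def flip: single_one)

lemma h1_act_gen: "h1_act s ops (h1_gen g) v = ops g v"
  by (simp add: h1_gen.abs_eq h1_act_abs free_act_def free_gen_def monoid_act_single[OF module_s])

lemma h1_act_linear: "module_hom s s (h1_act s ops h)"
  unfolding h1_act_def free_act_def by (rule monoid_act_linear[OF module_s module_hom_ops])

end

lemma h1_rel_YX: "commutator (h1_gen genY) (h1_gen genX) = h1_gen genX"
  unfolding commutator_def
  by transfer (auto simp: ideal_cong_def h1_relations_def commutator_def intro!: ideal_base)

lemma h1_rel_YD: "commutator (h1_gen genY) (h1_gen (genD n)) = of_nat (n + 1) * h1_gen (genD n)"
proof -
  have *: "of_nat k = abs_h1 (of_nat k)" for k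
    by (induction k) (auto simp: zero_h1.abs_eq one_h1.abs_eq plus_h1.abs_eq)
  show ?thesis
    unfolding commutator_def * h1_gen.abs_eq times_h1.abs_eq minus_h1.abs_eq h1.abs_eq_iff
      ideal_cong_def
    by (rule ideal_base) (auto simp: h1_relations_def commutator_def)
qed

lemma h1_rel_XD: "commutator (h1_gen genX) (h1_gen (genD n)) = h1_gen (genD (Suc n))"
  unfolding commutator_def
  by transfer (auto simp: ideal_cong_def h1_relations_def commutator_def intro!: ideal_base)

lemma h1_rel_DD: "commutator (h1_gen (genD k)) (h1_gen (genD l)) = 0"
  unfolding commutator_def
  by transfer (auto simp: ideal_cong_def h1_relations_def commutator_def intro!: ideal_base)

lemma pconst_central:
  fixes p :: "'m::monoid_add \<Rightarrow>\<^sub>0 complex"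
  shows "pconst c * p = p * pconst c"
  by (induction p rule: poly_mapping_single_induct)
     (auto simp: pconst_def mult_single distrib_left distrib_right mult.commute)

lemma h1_const_central: "h1_const c * h = h * h1_const c"
  by transfer (simp add: pconst_central ideal_cong_refl)

lemma h1_const_add: "h1_const (c + d) = h1_const c + h1_const d"
  by transfer (simp add: pconst_def single_add ideal_cong_refl)

lemma h1_const_mult: "h1_const (c * d) = h1_const c * h1_const d"
  by transfer (simp add: pconst_def mult_single ideal_cong_refl)

lemma h1_const_one: "h1_const 1 = 1"
  by transfer (simp add: pconst_def ideal_cong_refl)

lemma h1_counit_mult: "h1_counit (h * k) = h1_counit h * h1_counit k"
proof transfer
  fix p q :: h1_free
  have "free_counit (p * q) =
      monoid_act (*) (\<lambda>w z. if w = 0 then z else 0) p (free_counit q)"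
    unfolding free_counit_eq
    by (rule monoid_act_mult[OF module_complex module_hom_counit])
       (auto simp: free_monoid_sum_zero_iff)
  also have "\<dots> = free_counit q * free_counit p"
    using module_hom.scale[OF monoid_act_linear[OF module_complex module_hom_counit],
        of "\<lambda>w. w = 0" p "free_counit q" 1]
    by (simp add: free_counit_eq)
  finally show "free_counit (p * q) = free_counit p * free_counit q" by simp
qed

lemma h1_counit_add: "h1_counit (h + k) = h1_counit h + h1_counit k"
  by transfer (simp add: free_counit_def lookup_add)

lemma h1_counit_const: "h1_counit (h1_const c) = c"
  by transfer (simp add: free_counit_def pconst_def)

lemma h1_counit_one: "h1_counit 1 = 1"
  by transfer (simp add: free_counit_def lookup_one)


section \<open>The tensor square \<open>H\<^sub>1 \<otimes> H\<^sub>1\<close>\<close>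

text \<open>The pairs \<open>(a, b)\<close> with componentwise multiplication, again written additively, so that the
  convolution product on \<open>h1_pair \<Rightarrow>\<^sub>0 complex\<close> satisfies \<open>(a, b) * (c, d) = (a * c, b * d)\<close>. The tensor
  square is the quotient of this vector space by the bilinearity relations; they are stable under
  multiplication by pairs, so their span is an ideal.\<close>

datatype h1_pair = Pr h1 h1

instantiation h1_pair :: monoid_add
begin
definition "0 = Pr 1 1"
fun plus_h1_pair :: "h1_pair \<Rightarrow> h1_pair \<Rightarrow> h1_pair" where
  "plus_h1_pair (Pr a b) (Pr c d) = Pr (a * c) (b * d)"
instance
proof
  fix a b c :: h1_pair
  show "a + b + c = a + (b + c)" by (cases a; cases b; cases c) (simp add: mult.assoc)
  show "0 + a = a" "a + 0 = a" by (cases a; simp add: zero_h1_pair_def)+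
qed
end

definition pair_gen :: "h1 \<Rightarrow> h1 \<Rightarrow> (h1_pair \<Rightarrow>\<^sub>0 complex)" where
  "pair_gen a b = Poly_Mapping.single (Pr a b) 1"

inductive_set tensor_relations :: "(h1_pair \<Rightarrow>\<^sub>0 complex) set" where
  tr_add_left: "pair_gen (a + a') b - (pair_gen a b + pair_gen a' b) \<in> tensor_relations"
| tr_add_right: "pair_gen a (b + b') - (pair_gen a b + pair_gen a b') \<in> tensor_relations"
| tr_scale_left: "pair_gen (h1_const c * a) b - pconst c * pair_gen a b \<in> tensor_relations"
| tr_scale_right: "pair_gen a (h1_const c * b) - pconst c * pair_gen a b \<in> tensor_relations"

quotient_type h1_tensor = "h1_pair \<Rightarrow>\<^sub>0 complex" / "ideal_cong tensor_relations"
  by (rule equivp_ideal_cong)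

definition pair_counit :: "(h1_pair \<Rightarrow>\<^sub>0 complex) \<Rightarrow> complex" where
  "pair_counit p = monoid_act (*) (\<lambda>w z. case w of Pr a b \<Rightarrow> h1_counit a * h1_counit b * z) p 1"

lemma pair_counit_cong:
  assumes "ideal_cong tensor_relations p q"
  shows "pair_counit p = pair_counit q"
proof -
  let ?\<rho> = "\<lambda>w z. case w of Pr a b \<Rightarrow> h1_counit a * h1_counit b * z"
  have lin: "module_hom (*) (*) (?\<rho> w)" for w
    by (intro module_hom.intro module_complex)
       (cases w; unfold_locales; auto simp: algebra_simps)
  have mon: "?\<rho> (u + w) v = ?\<rho> u (?\<rho> w v)" for u w v
    by (cases u; cases w) (auto simp: h1_counit_mult)
  have rel: "monoid_act (*) ?\<rho> r v = 0" if "r \<in> tensor_relations" for r v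
    using that
    by cases (auto simp: pair_gen_def pconst_def mult_single zero_h1_pair_def
        monoid_act_diff[OF module_complex] monoid_act_add[OF module_complex]
        monoid_act_single[OF module_complex] h1_counit_add h1_counit_mult h1_counit_const distrib_left distrib_right)
  have "monoid_act (*) ?\<rho> (p - q) 1 = 0"
    by (rule monoid_act_ideal[OF module_complex lin mon rel])
       (use assms in \<open>auto simp: ideal_cong_def\<close>)
  then show ?thesis
    by (simp add: pair_counit_def monoid_act_diff[OF module_complex])
qed

instantiation h1_tensor :: ring_1
begin
lift_definition zero_h1_tensor :: h1_tensor is 0 .
lift_definition one_h1_tensor :: h1_tensor is 1 .
lift_definition plus_h1_tensor :: "h1_tensor \<Rightarrow> h1_tensor \<Rightarrow> h1_tensor" is "(+)"
  by (rule ideal_cong_add)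
lift_definition minus_h1_tensor :: "h1_tensor \<Rightarrow> h1_tensor \<Rightarrow> h1_tensor" is "(-)"
  by (rule ideal_cong_diff)
lift_definition uminus_h1_tensor :: "h1_tensor \<Rightarrow> h1_tensor" is uminus
  by (rule ideal_cong_uminus)
lift_definition times_h1_tensor :: "h1_tensor \<Rightarrow> h1_tensor \<Rightarrow> h1_tensor" is "(*)"
  by (rule ideal_cong_mult)
instance
proof
  have "pair_counit 0 \<noteq> pair_counit 1"
    by (simp add: pair_counit_def zero_h1_pair_def h1_counit_one monoid_act_single[OF module_complex]
        flip: single_one)
  then show "0 \<noteq> (1::h1_tensor)"
    by transfer (use pair_counit_cong in blast)
qed (transfer; simp add: algebra_simps ideal_cong_refl)+
end

lift_definition tensor_const :: "complex \<Rightarrow> h1_tensor" is pconst .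

lift_definition tensor :: "h1 \<Rightarrow> h1 \<Rightarrow> h1_tensor" (infix \<open>\<otimes>\<^sub>H\<close> 75) is
  "\<lambda>p q. pair_gen (abs_h1 p) (abs_h1 q)"
proof -
  fix p p' q q' :: h1_free
  assume "ideal_cong h1_relations p p'" "ideal_cong h1_relations q q'"
  then have "abs_h1 p = abs_h1 p'" "abs_h1 q = abs_h1 q'"
    by (simp_all add: h1.abs_eq_iff)
  then show "ideal_cong tensor_relations (pair_gen (abs_h1 p) (abs_h1 q)) (pair_gen (abs_h1 p') (abs_h1 q'))"
    by (simp add: ideal_cong_refl)
qed

lemma tensor_abs: "a \<otimes>\<^sub>H b = abs_h1_tensor (pair_gen a b)"
  by (induction a; induction b) (simp add: tensor.abs_eq)

lemma tensor_add_left: "(a + a') \<otimes>\<^sub>H b = a \<otimes>\<^sub>H b + a' \<otimes>\<^sub>H b"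
  unfolding tensor_abs plus_h1_tensor.abs_eq h1_tensor.abs_eq_iff ideal_cong_def
  by (rule ideal_base[OF tr_add_left])

lemma tensor_add_right: "a \<otimes>\<^sub>H (b + b') = a \<otimes>\<^sub>H b + a \<otimes>\<^sub>H b'"
  unfolding tensor_abs plus_h1_tensor.abs_eq h1_tensor.abs_eq_iff ideal_cong_def
  by (rule ideal_base[OF tr_add_right])

lemma tensor_scale_left: "(h1_const c * a) \<otimes>\<^sub>H b = tensor_const c * (a \<otimes>\<^sub>H b)"
  unfolding tensor_abs tensor_const.abs_eq times_h1_tensor.abs_eq h1_tensor.abs_eq_iff ideal_cong_def
  by (rule ideal_base[OF tr_scale_left])

lemma tensor_scale_right: "a \<otimes>\<^sub>H (h1_const c * b) = tensor_const c * (a \<otimes>\<^sub>H b)"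
  unfolding tensor_abs tensor_const.abs_eq times_h1_tensor.abs_eq h1_tensor.abs_eq_iff ideal_cong_def
  by (rule ideal_base[OF tr_scale_right])

lemma tensor_mult: "(a \<otimes>\<^sub>H b) * (c \<otimes>\<^sub>H d) = (a * c) \<otimes>\<^sub>H (b * d)"
  by (simp add: tensor_abs times_h1_tensor.abs_eq pair_gen_def mult_single)

lemma tensor_one: "1 \<otimes>\<^sub>H 1 = 1"
  by (simp add: tensor_abs one_h1_tensor.abs_eq pair_gen_def flip: zero_h1_pair_def)

lemma tensor_diff_left: "(a - a') \<otimes>\<^sub>H b = a \<otimes>\<^sub>H b - a' \<otimes>\<^sub>H b"
  using tensor_add_left[of "a - a'" a' b] by (simp add: algebra_simps)

lemma tensor_diff_right: "a \<otimes>\<^sub>H (b - b') = a \<otimes>\<^sub>H b - a \<otimes>\<^sub>H b'"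
  using tensor_add_right[of a "b - b'" b'] by (simp add: algebra_simps)

lemma tensor_const_central: "tensor_const c * t = t * tensor_const c"
  by transfer (simp add: pconst_central ideal_cong_refl)

lemma tensor_const_add: "tensor_const (c + d) = tensor_const c + tensor_const d"
  by transfer (simp add: pconst_def single_add ideal_cong_refl)

lemma tensor_const_mult: "tensor_const (c * d) = tensor_const c * tensor_const d"
  by transfer (simp add: pconst_def mult_single ideal_cong_refl)

lemma tensor_const_one: "tensor_const 1 = 1"
  by transfer (simp add: pconst_def ideal_cong_refl)

lemma module_tensor: "module (\<lambda>c t. tensor_const c * t)"
  by unfold_locales
    (simp_all only: tensor_const_add tensor_const_mult tensor_const_one distrib_left distrib_right
      mult.assoc mult_1_left)

text \<open>Every tensor is a finite sum of pure tensors, so Sweedler representations exist.\<close>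

lemma ex_sum_pure_tensors:
  "\<exists>(n::nat) h' h''. t = (\<Sum>i<n. h' i \<otimes>\<^sub>H h'' i)"
proof -
  have "\<exists>n h' h''. abs_h1_tensor p = (\<Sum>i<n::nat. h' i \<otimes>\<^sub>H h'' i)" for p
  proof (induction p rule: poly_mapping_single_induct)
    case zero
    have "abs_h1_tensor 0 = (\<Sum>i<0::nat. h' i \<otimes>\<^sub>H h'' i)" for h' h''
      by (simp add: zero_h1_tensor.abs_eq)
    then show ?case by blast
  next
    case (single_add k c p)
    obtain a b where k: "k = Pr a b" by (cases k)
    obtain n h' h'' where IH: "abs_h1_tensor p = (\<Sum>i<n::nat. h' i \<otimes>\<^sub>H h'' i)"
      using single_add by blast
    have *: "abs_h1_tensor (Poly_Mapping.single k c) = (h1_const c * a) \<otimes>\<^sub>H b"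
      unfolding tensor_scale_left
      by (simp add: tensor_abs tensor_const.abs_eq times_h1_tensor.abs_eq pair_gen_def pconst_def
          mult_single k zero_h1_pair_def)
    have "abs_h1_tensor (Poly_Mapping.single k c + p) =
        (\<Sum>i<Suc n. (h'(n := h1_const c * a)) i \<otimes>\<^sub>H (h''(n := b)) i)"
      by (simp add: plus_h1_tensor.abs_eq[symmetric] IH * add.commute)
    then show ?case by blast
  qed
  then show ?thesis by (induction t) auto
qed


section \<open>Coproduct and character\<close>

definition coproduct_X :: h1_tensor where
  "coproduct_X = h1_gen genX \<otimes>\<^sub>H 1 + 1 \<otimes>\<^sub>H h1_gen genX + h1_gen (genD 0) \<otimes>\<^sub>H h1_gen genY"

text \<open>The values on \<open>\<delta>\<^sub>n\<close>, \<open>n \<ge> 2\<close>, are forced by \<open>[X, \<delta>\<^sub>n] = \<delta>\<^bsub>n+1\<^esub>\<close>.\<close>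

primrec coproduct_delta :: "nat \<Rightarrow> h1_tensor" where
  "coproduct_delta 0 = h1_gen (genD 0) \<otimes>\<^sub>H 1 + 1 \<otimes>\<^sub>H h1_gen (genD 0)"
| "coproduct_delta (Suc n) = commutator coproduct_X (coproduct_delta n)"

fun coproduct_gen :: "h1_gen \<Rightarrow> h1_tensor" where
  "coproduct_gen genX = coproduct_X"
| "coproduct_gen genY = h1_gen genY \<otimes>\<^sub>H 1 + 1 \<otimes>\<^sub>H h1_gen genY"
| "coproduct_gen (genD n) = coproduct_delta n"

lemma coproduct_gen_D_Suc:
  "coproduct_gen (genD (Suc n)) = commutator (coproduct_gen genX) (coproduct_gen (genD n))"
  by simp

definition coproduct :: "h1 \<Rightarrow> h1_tensor" where
  "coproduct h = h1_act (\<lambda>c t. tensor_const c * t) (\<lambda>g t. coproduct_gen g * t) h 1"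

definition character_gen :: "h1_gen \<Rightarrow> complex" where
  "character_gen g = (case g of genY \<Rightarrow> 1 | genX \<Rightarrow> 0 | genD n \<Rightarrow> 0)"

definition character :: "h1 \<Rightarrow> complex" where
  "character h = h1_act (*) (\<lambda>g z. character_gen g * z) h 1"

text \<open>The subalgebra generated by the \<open>\<delta>\<^sub>n\<close> is commutative.\<close>

inductive_set delta_alg :: "h1 set" where
  delta_gen: "h1_gen (genD n) \<in> delta_alg"
| delta_const: "h1_const c \<in> delta_alg"
| delta_add: "\<lbrakk>a \<in> delta_alg; b \<in> delta_alg\<rbrakk> \<Longrightarrow> a + b \<in> delta_alg"
| delta_mult: "\<lbrakk>a \<in> delta_alg; b \<in> delta_alg\<rbrakk> \<Longrightarrow> a * b \<in> delta_alg"

lemma commute_mult: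
  fixes a b c :: "'a::semigroup_mult"
  assumes "a * c = c * a" "b * c = c * b"
  shows "(a * b) * c = c * (a * b)"
  using assms by (metis mult.assoc)

lemma delta_alg_commute:
  assumes "a \<in> delta_alg" "b \<in> delta_alg"
  shows "a * b = b * a"
  using assms(1)
proof induction
  case (delta_gen n)
  show ?case using assms(2)
  proof induction
    case (delta_gen k)
    show ?case using h1_rel_DD[of n k] by (simp add: commutator_def)
  next
    case (delta_mult a b)
    then show ?case using commute_mult[of a "h1_gen (genD n)" b] by metis
  qed (auto simp: distrib_left distrib_right h1_const_central)
next
  case (delta_mult a a')
  then show ?case using commute_mult by metis
qed (auto simp: distrib_left distrib_right h1_const_central)

lemma commutator_add_right: "commutator x (a + b) = commutator x a + commutator x b"
  by (simp add: commutator_def algebra_simps)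

lemma commutator_add_left: "commutator (x + y) a = commutator x a + commutator y a"
  by (simp add: commutator_def algebra_simps)

lemma commutator_mult_right: "commutator x (a * b) = commutator x a * b + a * commutator x b"
  by (simp add: commutator_def algebra_simps)

lemma commutator_jacobi:
  "commutator x (commutator y z) = commutator (commutator x y) z + commutator y (commutator x z)"
  by (simp add: commutator_def algebra_simps)

lemma delta_alg_zero: "0 \<in> delta_alg"
  using delta_const[of 0] h1_const_add[of 0 0] by simp

lemma delta_alg_one: "1 \<in> delta_alg"
  using delta_const[of 1] by (simp add: h1_const_one)

lemma delta_alg_of_nat: "of_nat n \<in> delta_alg"
  by (induction n) (auto intro: delta_alg_zero delta_alg_one delta_add)

lemma commutator_X_delta_alg: "a \<in> delta_alg \<Longrightarrow> commutator (h1_gen genX) a \<in> delta_alg"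
proof (induction rule: delta_alg.induct)
  case (delta_gen n)
  show ?case by (simp only: h1_rel_XD delta_alg.delta_gen)
next
  case (delta_const c)
  show ?case by (simp add: commutator_def h1_const_central delta_alg_zero)
qed (auto simp: commutator_add_right commutator_mult_right intro!: delta_add delta_mult)

lemma commutator_Y_delta_alg: "a \<in> delta_alg \<Longrightarrow> commutator (h1_gen genY) a \<in> delta_alg"
proof (induction rule: delta_alg.induct)
  case (delta_gen n)
  show ?case unfolding h1_rel_YD
    by (intro delta_mult delta_alg.delta_gen delta_alg_of_nat)
next
  case (delta_const c)
  show ?case by (simp add: commutator_def h1_const_central delta_alg_zero)
qed (auto simp: commutator_add_right commutator_mult_right intro!: delta_add delta_mult)

inductive_set delta_tensor :: "h1_tensor set" where
  dt_pure: "\<lbrakk>a \<in> delta_alg; b \<in> delta_alg\<rbrakk> \<Longrightarrow> a \<otimes>\<^sub>H b \<in> delta_tensor"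
| dt_add: "\<lbrakk>s \<in> delta_tensor; t \<in> delta_tensor\<rbrakk> \<Longrightarrow> s + t \<in> delta_tensor"

lemma delta_tensor_commute:
  assumes "s \<in> delta_tensor" "t \<in> delta_tensor"
  shows "s * t = t * s"
  using assms(1)
proof induction
  case (dt_pure a b)
  show ?case using assms(2)
    by induction
       (use dt_pure in \<open>auto simp: tensor_mult delta_alg_commute distrib_left distrib_right\<close>)
qed (auto simp: distrib_left distrib_right)

lemma commutator_pure_left:
  "commutator (x \<otimes>\<^sub>H 1) (a \<otimes>\<^sub>H b) = commutator x a \<otimes>\<^sub>H b"
  "commutator (1 \<otimes>\<^sub>H y) (a \<otimes>\<^sub>H b) = a \<otimes>\<^sub>H commutator y b"
  by (simp_all add: commutator_def tensor_mult tensor_diff_left tensor_diff_right)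

lemma coproduct_X_delta_tensor:
  assumes "t \<in> delta_tensor"
  shows "commutator (coproduct_gen genX) t \<in> delta_tensor"
  using assms
proof induction
  case (dt_pure a b)
  have "commutator (h1_gen (genD 0) \<otimes>\<^sub>H h1_gen genY) (a \<otimes>\<^sub>H b) =
      (h1_gen (genD 0) * a) \<otimes>\<^sub>H commutator (h1_gen genY) b"
    using delta_alg_commute[OF dt_pure(1) delta_gen[of 0]]
    by (simp add: commutator_def tensor_mult tensor_diff_right)
  then show ?case
    by (auto simp: coproduct_X_def commutator_add_left commutator_pure_left
        intro!: delta_tensor.intros commutator_X_delta_alg commutator_Y_delta_alg dt_pure
          delta_gen delta_mult)
qed (auto simp only: commutator_add_right intro: dt_add)

lemma coproduct_delta_in: "coproduct_gen (genD n) \<in> delta_tensor"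
proof (induction n)
  case 0
  show ?case by (auto intro!: delta_tensor.intros delta_gen delta_alg_one)
next
  case (Suc n)
  then show ?case unfolding coproduct_gen_D_Suc by (rule coproduct_X_delta_tensor)
qed

lemma coproduct_rel_DD: "coproduct_gen (genD k) * coproduct_gen (genD l) = coproduct_gen (genD l) * coproduct_gen (genD k)"
  by (rule delta_tensor_commute[OF coproduct_delta_in coproduct_delta_in])

lemma coproduct_rel_YX: "commutator (coproduct_gen genY) (coproduct_gen genX) = coproduct_gen genX"
proof -
  have "commutator (h1_gen genY) 1 = 0" "commutator (h1_gen genY) (h1_gen genY) = 0"
    by (simp_all add: commutator_def)
  moreover have "a \<otimes>\<^sub>H 0 = 0" "0 \<otimes>\<^sub>H a = 0" for a
    using tensor_add_left[of 0 0 a] tensor_add_right[of a 0 0] by simp_all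
  moreover have "commutator (h1_gen genY) (h1_gen (genD 0)) = h1_gen (genD 0)"
    using h1_rel_YD[of 0] by simp
  ultimately show ?thesis
    by (simp add: coproduct_X_def commutator_add_left commutator_add_right commutator_pure_left h1_rel_YX)
qed

lemma coproduct_rel_YD:
  "commutator (coproduct_gen genY) (coproduct_gen (genD n)) = of_nat (n + 1) * coproduct_gen (genD n)"
proof (induction n)
  case 0
  have "commutator (h1_gen genY) 1 = 0" by (simp add: commutator_def)
  moreover have "a \<otimes>\<^sub>H 0 = 0" "0 \<otimes>\<^sub>H a = 0" for a
    using tensor_add_left[of 0 0 a] tensor_add_right[of a 0 0] by simp_all
  moreover have "commutator (h1_gen genY) (h1_gen (genD 0)) = h1_gen (genD 0)"
    using h1_rel_YD[of 0] by simp
  ultimately show ?case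
    by (simp add: commutator_add_left commutator_add_right commutator_pure_left)
next
  case (Suc n)
  have "commutator (coproduct_gen genY) (coproduct_gen (genD (Suc n))) =
      commutator (coproduct_gen genX) (coproduct_gen (genD n)) +
      commutator (coproduct_gen genX) (of_nat (n + 1) * coproduct_gen (genD n))"
    unfolding coproduct_gen_D_Suc commutator_jacobi[of "coproduct_gen genY"] coproduct_rel_YX Suc ..
  also have "commutator (coproduct_gen genX) (of_nat (n + 1) * coproduct_gen (genD n)) =
      of_nat (n + 1) * commutator (coproduct_gen genX) (coproduct_gen (genD n))"
    unfolding commutator_mult_right
    by (simp add: commutator_def mult_of_nat_commute algebra_simps)
  finally show ?case by (simp add: algebra_simps)
qed

lemma tensor_const_of_nat: "tensor_const (of_nat n) = of_nat n"
proof -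
  have "of_nat n = abs_h1_tensor (of_nat n)"
    by (induction n) (auto simp: zero_h1_tensor.abs_eq one_h1_tensor.abs_eq plus_h1_tensor.abs_eq)
  then show ?thesis
    by (simp add: tensor_const.abs_eq pconst_def)
qed

lemma h1_module_coproduct: "h1_module (\<lambda>c t. tensor_const c * t) (\<lambda>g t. coproduct_gen g * t)"
  unfolding h1_module_def
proof (intro conjI allI)
  show "module_hom (\<lambda>c t. tensor_const c * t) (\<lambda>c t. tensor_const c * t) (\<lambda>t. coproduct_gen g * t)" for g
    by (intro module_hom.intro module_tensor, unfold_locales)
       (auto simp: distrib_left tensor_const_central mult.assoc)
  show "coproduct_gen genY * (coproduct_gen genX * v) - coproduct_gen genX * (coproduct_gen genY * v) =
      coproduct_gen genX * v" for v
    using arg_cong[OF coproduct_rel_YX, of "\<lambda>x. x * v"]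
    by (simp only: commutator_def left_diff_distrib mult.assoc)
  show "coproduct_gen genY * (coproduct_gen (genD n) * v) - coproduct_gen (genD n) * (coproduct_gen genY * v) =
      tensor_const (of_nat (n + 1)) * (coproduct_gen (genD n) * v)" for n v
    using arg_cong[OF coproduct_rel_YD, of "\<lambda>x. x * v" n]
    by (simp only: commutator_def left_diff_distrib mult.assoc tensor_const_of_nat)
  show "coproduct_gen genX * (coproduct_gen (genD n) * v) - coproduct_gen (genD n) * (coproduct_gen genX * v) =
      coproduct_gen (genD (Suc n)) * v" for n v
    by (simp only: coproduct_gen_D_Suc commutator_def left_diff_distrib mult.assoc)
  show "coproduct_gen (genD k) * (coproduct_gen (genD l) * v) = coproduct_gen (genD l) * (coproduct_gen (genD k) * v)"
    for k l v
    using arg_cong[OF coproduct_rel_DD, of "\<lambda>x. x * v" k l] by (simp only: mult.assoc)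
qed (rule module_tensor)

lemma coproduct_gen: "coproduct (h1_gen g) = coproduct_gen g"
  by (simp add: coproduct_def h1_act_gen[OF h1_module_coproduct])

lemma coproduct_one: "coproduct 1 = 1"
  by (simp add: coproduct_def h1_act_one[OF h1_module_coproduct])

lemma coproduct_const: "coproduct (h1_const c) = tensor_const c"
  by (simp add: coproduct_def h1_act_const[OF h1_module_coproduct])

lemma coproduct_add: "coproduct (h + k) = coproduct h + coproduct k"
  by (simp add: coproduct_def h1_act_add[OF h1_module_coproduct])

lemma h1_act_right_mult:
  "h1_act (\<lambda>c t. tensor_const c * t) (\<lambda>g t. coproduct_gen g * t) h v =
   h1_act (\<lambda>c t. tensor_const c * t) (\<lambda>g t. coproduct_gen g * t) h 1 * v"
proof -
  have "foldr (\<lambda>g t. coproduct_gen g * t) w v = foldr (\<lambda>g t. coproduct_gen g * t) w 1 * v" for w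
    by (induction w) (auto simp: mult.assoc)
  then show ?thesis
    by (simp add: h1_act_def free_act_def monoid_act_def pm_extend_def sum_distrib_right mult.assoc)
qed

lemma coproduct_mult: "coproduct (h * k) = coproduct h * coproduct k"
  by (subst (1) coproduct_def, subst h1_act_mult[OF h1_module_coproduct], subst h1_act_right_mult)
     (simp add: coproduct_def)

lemma h1_module_character: "h1_module (*) (\<lambda>g z. character_gen g * z)"
  unfolding h1_module_def
proof (intro conjI allI)
  show "module_hom (*) (*) (\<lambda>z. character_gen g * z)" for g
    by (intro module_hom.intro module_complex, unfold_locales) (auto simp: algebra_simps)
qed (auto simp: character_gen_def module_complex)

lemma character_gen:
  "character (h1_gen genX) = 0" "character (h1_gen genY) = 1" "character (h1_gen (genD n)) = 0"
  unfolding character_def h1_act_gen[OF h1_module_character] by (simp_all add: character_gen_def)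

lemma character_add: "character (h + k) = character h + character k"
  by (simp add: character_def h1_act_add[OF h1_module_character])

lemma character_const: "character (h1_const c) = c"
  by (simp add: character_def h1_act_const[OF h1_module_character])

lemma character_one: "character 1 = 1"
  by (simp add: character_def h1_act_one[OF h1_module_character])

lemma character_mult: "character (h * k) = character h * character k"
  using module_hom.scale[OF h1_act_linear[OF h1_module_character], of h "character k" 1]
  by (simp add: character_def h1_act_mult[OF h1_module_character])


section \<open>Modular forms of all levels\<close>

definition mobius :: "real^2^2 \<Rightarrow> complex \<Rightarrow> complex" where
  "mobius A z = (of_real (A$1$1) * z + of_real (A$1$2)) / (of_real (A$2$1) * z + of_real (A$2$2))"

definition slash :: "nat \<Rightarrow> (complex \<Rightarrow> complex) \<Rightarrow> real^2^2 \<Rightarrow> complex \<Rightarrow> complex" where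
  "slash k f A z =
     of_real (det A powr (real k / 2)) / (of_real (A$2$1) * z + of_real (A$2$2)) ^ k * f (mobius A z)"

definition principal_congruence :: "nat \<Rightarrow> (real^2^2) set" where
  "principal_congruence N =
     {A. det A = 1 \<and> (\<forall>i j. \<exists>n::int. A$i$j = (mat 1 :: real^2^2)$i$j + real N * of_int n)}"

definition has_q_expansion :: "nat \<Rightarrow> (complex \<Rightarrow> complex) \<Rightarrow> (nat \<Rightarrow> complex) \<Rightarrow> bool" where
  "has_q_expansion N f a \<longleftrightarrow>
     (\<forall>z. Im z > 0 \<longrightarrow> (\<lambda>n. a n * exp (2 * of_real pi * \<i> * of_nat n * z / of_nat N)) sums f z)"

text \<open>Functions on the upper half-plane are extended by zero. The weight is a natural number
  since there are no nonzero holomorphic modular forms of negative weight.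
  Holomorphy at all cusps is the existence of the expansion for all translates under
  \<open>SL\<^sub>2(\<int>) = \<Gamma>(1)\<close>.\<close>

definition modular_forms_level :: "nat \<Rightarrow> nat \<Rightarrow> (complex \<Rightarrow> complex) set" where
  "modular_forms_level N k =
     {f. f holomorphic_on {z. Im z > 0} \<and> (\<forall>z. Im z \<le> 0 \<longrightarrow> f z = 0) \<and>
         (\<forall>A\<in>principal_congruence N. slash k f A = f) \<and>
         (\<forall>A\<in>principal_congruence 1. \<exists>a. has_q_expansion N (slash k f A) a)}"

definition modular_forms :: "nat \<Rightarrow> (complex \<Rightarrow> complex) set" where
  "modular_forms k = (\<Union>N\<in>{1..}. modular_forms_level N k)"

definition const_coeff :: "(complex \<Rightarrow> complex) \<Rightarrow> complex" where
  "const_coeff f = (THE c. \<exists>N a. N \<ge> 1 \<and> has_q_expansion N f a \<and> a 0 = c)"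


section \<open>The group \<open>GL\<^sup>+(2,\<rat>)\<close>\<close>

typedef gl2q = "{A :: real^2^2. (\<forall>i j. A$i$j \<in> \<rat>) \<and> det A > 0}"
  morphisms mat_of Abs_gl2q
  by (rule exI[of _ "mat 1"]) (auto simp: mat_def det_2)

setup_lifting type_definition_gl2q

instantiation gl2q :: monoid_mult
begin
lift_definition one_gl2q :: gl2q is "mat 1" by (auto simp: mat_def det_2)
lift_definition times_gl2q :: "gl2q \<Rightarrow> gl2q \<Rightarrow> gl2q" is "(**)"
proof -
  fix A B :: "real^2^2"
  assume *: "(\<forall>i j. A$i$j \<in> \<rat>) \<and> 0 < det A" "(\<forall>i j. B$i$j \<in> \<rat>) \<and> 0 < det B"
  have "(A ** B)$i$j \<in> \<rat>" for i j
    using * by (simp add: matrix_matrix_mult_def sum_2)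
  moreover have "0 < det (A ** B)" using * by (simp add: det_mul)
  ultimately show "(\<forall>i j. (A ** B)$i$j \<in> \<rat>) \<and> 0 < det (A ** B)" by blast
qed
instance
proof
  fix a b c :: gl2q
  show "a * b * c = a * (b * c)" by transfer (rule matrix_mul_assoc[symmetric])
  show "1 * a = a" by transfer (rule matrix_mul_lid)
  show "a * 1 = a" by transfer (rule matrix_mul_rid)
qed
end

lift_definition gl2q_inv :: "gl2q \<Rightarrow> gl2q" is
  "\<lambda>A. vector [vector [A$2$2 / det A, - A$1$2 / det A], vector [- A$2$1 / det A, A$1$1 / det A]]"
proof -
  fix A :: "real^2^2"
  assume A: "(\<forall>i j. A$i$j \<in> \<rat>) \<and> 0 < det A"
  then have rat: "A$i$j \<in> \<rat>" "det A \<in> \<rat>" for i j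
    by (auto simp: det_2)
  let ?B = "vector [vector [A$2$2 / det A, - A$1$2 / det A],
      vector [- A$2$1 / det A, A$1$1 / det A]] :: real^2^2"
  have B: "?B$1$1 = A$2$2 / det A" "?B$1$2 = - A$1$2 / det A"
    "?B$2$1 = - A$2$1 / det A" "?B$2$2 = A$1$1 / det A"
    by simp_all
  have "det ?B = A$2$2 / det A * (A$1$1 / det A) - (- A$1$2 / det A) * (- A$2$1 / det A)"
    unfolding det_2[of ?B] B ..
  also have "\<dots> = (A$1$1 * A$2$2 - A$1$2 * A$2$1) / (det A * det A)"
    by (simp add: diff_divide_distrib mult.commute)
  also have "\<dots> = det A / (det A * det A)"
    by (simp only: det_2[of A])
  also have "\<dots> > 0" using A by simp
  finally have "0 < det ?B" .
  moreover have "?B$i$j \<in> \<rat>" for i j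
  proof -
    have "\<forall>i j. ?B$i$j \<in> \<rat>"
      unfolding forall_2 B using rat by simp
    then show ?thesis by blast
  qed
  ultimately show "(\<forall>i j. ?B$i$j \<in> \<rat>) \<and> 0 < det ?B" by blast
qed

lemma gl2q_inv: "g * gl2q_inv g = 1" "gl2q_inv g * g = 1"
proof -
  have *: "A ** vector [vector [A$2$2 / d, - A$1$2 / d], vector [- A$2$1 / d, A$1$1 / d]] = mat 1"
      "vector [vector [A$2$2 / d, - A$1$2 / d], vector [- A$2$1 / d, A$1$1 / d]] ** A = mat 1"
    if "d = det A" "0 < det A" for A :: "real^2^2" and d
  proof -
    have "(A$1$1 * A$2$2 - A$1$2 * A$2$1) / d = 1"
      using that unfolding det_2 by simp
    then have "A$1$1 * A$2$2 / d - A$1$2 * A$2$1 / d = 1"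
      by (simp only: diff_divide_distrib)
    then show "A ** vector [vector [A$2$2 / d, - A$1$2 / d], vector [- A$2$1 / d, A$1$1 / d]] = mat 1"
      "vector [vector [A$2$2 / d, - A$1$2 / d], vector [- A$2$1 / d, A$1$1 / d]] ** A = mat 1"
      by (simp_all add: vec_eq_iff forall_2 matrix_matrix_mult_def sum_2 mat_def mult.commute)
  qed
  show "g * gl2q_inv g = 1" by transfer (rule *(1); simp)
  show "gl2q_inv g * g = 1" by transfer (rule *(2); simp)
qed

lemma gl2q_inv_one: "gl2q_inv 1 = 1"
  using gl2q_inv(1)[of 1] by simp

lemma slash_one: "slash k f (mat_of 1) = f"
  by (simp add: fun_eq_iff slash_def mobius_def one_gl2q.rep_eq mat_def det_2)


section \<open>The crossed product \<open>\<A> = \<M> \<ltimes> GL\<^sup>+(2,\<rat>)\<close>\<close>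

text \<open>The coefficient at \<open>(k, \<gamma>)\<close> is the weight \<open>k\<close> part of \<open>f\<^sub>\<gamma>\<close> in \<open>\<Sum> f\<^sub>\<gamma> U\<^sub>\<gamma>\<close>. The
  operations are defined for arbitrary functions in place of modular forms.\<close>

type_synonym crossed = "(nat \<times> gl2q) \<Rightarrow>\<^sub>0 (complex \<Rightarrow> complex)"

definition crossed_product :: "crossed set" where
  "crossed_product = {a. \<forall>k g. Poly_Mapping.lookup a (k, g) \<in> modular_forms k}"

definition crossed_scale :: "complex \<Rightarrow> crossed \<Rightarrow> crossed" where
  "crossed_scale c = Poly_Mapping.map (\<lambda>f z. c * f z)"

definition crossed_mult :: "crossed \<Rightarrow> crossed \<Rightarrow> crossed" (infixl \<open>\<star>\<close> 70) where
  "a \<star> b =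
     pm_extend (\<lambda>(k, \<alpha>) f.
       pm_extend (\<lambda>(l, \<beta>) g.
         Poly_Mapping.single (k + l, \<alpha> * \<beta>) (f * slash l g (mat_of (gl2q_inv \<alpha>)))) b) a"


section \<open>The degenerate action\<close>

definition degenerate_Y :: "nat \<Rightarrow> crossed \<Rightarrow> crossed" where
  "degenerate_Y m = Poly_Mapping.mapp (\<lambda>(k, g) f z. of_nat k / of_nat m * f z)"

definition degenerate_X :: "nat \<Rightarrow> (complex \<Rightarrow> complex) \<Rightarrow> crossed \<Rightarrow> crossed" where
  "degenerate_X m \<omega> a = Poly_Mapping.single (m, 1) \<omega> \<star> degenerate_Y m a"

primrec degenerate_delta :: "nat \<Rightarrow> (complex \<Rightarrow> complex) \<Rightarrow> nat \<Rightarrow> crossed \<Rightarrow> crossed" where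
  "degenerate_delta m \<omega> 0 = (\<lambda>a.
     Poly_Mapping.single (m, 1) \<omega> \<star> a - a \<star> Poly_Mapping.single (m, 1) \<omega>)"
| "degenerate_delta m \<omega> (Suc n) = (\<lambda>a.
     degenerate_X m \<omega> (degenerate_delta m \<omega> n a) - degenerate_delta m \<omega> n (degenerate_X m \<omega> a))"

fun degenerate_gen :: "nat \<Rightarrow> (complex \<Rightarrow> complex) \<Rightarrow> h1_gen \<Rightarrow> crossed \<Rightarrow> crossed" where
  "degenerate_gen m \<omega> genX = degenerate_X m \<omega>"
| "degenerate_gen m \<omega> genY = degenerate_Y m"
| "degenerate_gen m \<omega> (genD n) = degenerate_delta m \<omega> n"

definition degenerate_action :: "nat \<Rightarrow> (complex \<Rightarrow> complex) \<Rightarrow> h1 \<Rightarrow> crossed \<Rightarrow> crossed" where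
  "degenerate_action m \<omega> = h1_act crossed_scale (degenerate_gen m \<omega>)"

lemma slash_add: "slash k (f + g) A = slash k f A + slash k g A"
  by (simp add: fun_eq_iff slash_def distrib_left)

lemma slash_zero: "slash k 0 A = 0"
  by (simp add: fun_eq_iff slash_def)

lemma slash_scale: "slash k (\<lambda>z. c * f z) A = (\<lambda>z. c * slash k f A z)"
  by (simp add: fun_eq_iff slash_def)

lemma lookup_crossed_scale: "Poly_Mapping.lookup (crossed_scale c a) k = (\<lambda>z. c * Poly_Mapping.lookup a k z)"
  by (auto simp: crossed_scale_def map.rep_eq when_def fun_eq_iff)

lemma module_crossed: "module crossed_scale"
  by unfold_locales
     (auto intro!: poly_mapping_eqI simp: lookup_crossed_scale lookup_add fun_eq_iff algebra_simps)

lemma crossed_scale_single: "crossed_scale c (Poly_Mapping.single k f) = Poly_Mapping.single k (\<lambda>z. c * f z)"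
  by (auto intro!: poly_mapping_eqI simp: lookup_crossed_scale lookup_single when_def fun_eq_iff)

lemma crossed_mult_single:
  "Poly_Mapping.single (k, \<alpha>) f \<star> Poly_Mapping.single (l, \<beta>) g =
   Poly_Mapping.single (k + l, \<alpha> * \<beta>) (f * slash l g (mat_of (gl2q_inv \<alpha>)))"
  by (simp add: crossed_mult_def pm_extend_single pm_extend_def slash_zero split_beta)

lemma crossed_mult_add_left: "(a + b) \<star> c = a \<star> c + b \<star> c"
  unfolding crossed_mult_def
  by (rule pm_extend_add)
     (auto simp: pm_extend_def split_beta distrib_right single_add sum.distrib)

lemma crossed_mult_add_right: "a \<star> (b + c) = a \<star> b + a \<star> c"
proof -
  have "pm_extend (\<lambda>(l, \<beta>) g. Poly_Mapping.single (k + l, \<alpha> * \<beta>) (f * slash l g A)) (b + c) =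
     pm_extend (\<lambda>(l, \<beta>) g. Poly_Mapping.single (k + l, \<alpha> * \<beta>) (f * slash l g A)) b +
     pm_extend (\<lambda>(l, \<beta>) g. Poly_Mapping.single (k + l, \<alpha> * \<beta>) (f * slash l g A)) c" for k \<alpha> f A
    by (rule pm_extend_add) (auto simp: slash_zero slash_add distrib_left single_add)
  then show ?thesis
    unfolding crossed_mult_def pm_extend_def[of _ a] by (simp add: split_beta sum.distrib)
qed

lemma crossed_mult_zero [simp]: "0 \<star> a = 0" "a \<star> 0 = 0"
  by (simp_all add: crossed_mult_def pm_extend_def split_beta)

lemma lookup_degenerate_Y:
  "Poly_Mapping.lookup (degenerate_Y m a) k = (\<lambda>z. of_nat (fst k) / of_nat m * Poly_Mapping.lookup a k z)"
  by (auto simp: degenerate_Y_def lookup_mapp when_def fun_eq_iff in_keys_iff split_beta)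

lemma degenerate_Y_add: "degenerate_Y m (a + b) = degenerate_Y m a + degenerate_Y m b"
  by (rule poly_mapping_eqI) (simp add: lookup_degenerate_Y lookup_add fun_eq_iff distrib_left)

lemma degenerate_Y_single:
  "degenerate_Y m (Poly_Mapping.single (k, g) f) =
   Poly_Mapping.single (k, g) (\<lambda>z. of_nat k / of_nat m * f z)"
  by (auto intro!: poly_mapping_eqI simp: lookup_degenerate_Y lookup_single when_def fun_eq_iff)

lemma degenerate_X_add: "degenerate_X m \<omega> (a + b) = degenerate_X m \<omega> a + degenerate_X m \<omega> b"
  by (simp add: degenerate_X_def degenerate_Y_add crossed_mult_add_right)

lemma degenerate_X_single:
  "degenerate_X m \<omega> (Poly_Mapping.single (k, g) f) =
   Poly_Mapping.single (k + m, g) (\<lambda>z. of_nat k / of_nat m * \<omega> z * f z)"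
  by (simp add: degenerate_X_def degenerate_Y_single crossed_mult_single gl2q_inv_one slash_one
      add.commute times_fun_def mult.left_commute mult.assoc)

lemma degenerate_delta_add:
  "degenerate_delta m \<omega> n (a + b) = degenerate_delta m \<omega> n a + degenerate_delta m \<omega> n b"
  by (induction n arbitrary: a b)
     (simp_all add: crossed_mult_add_left crossed_mult_add_right degenerate_X_add)

lemma degenerate_delta_single:
  assumes "m > 0"
  shows "degenerate_delta m \<omega> n (Poly_Mapping.single (k, g) f) =
    Poly_Mapping.single (k + (n + 1) * m, g)
      (\<lambda>z. fact n * \<omega> z ^ n * (\<omega> z - slash m \<omega> (mat_of (gl2q_inv g)) z) * f z)"
proof (induction n arbitrary: k f)
  case 0
  show ?case
    by (auto intro!: poly_mapping_eqI simp: crossed_mult_single gl2q_inv_one slash_one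
        lookup_minus lookup_add lookup_single when_def fun_eq_iff algebra_simps)
next
  case (Suc n)
  have "(of_nat k + of_nat (n + 1) * of_nat m) / of_nat m = of_nat k / of_nat m + (of_nat (n + 1) :: complex)"
    using assms unfolding add_divide_distrib by simp
  then have eq: "of_nat (k + (n + 1) * m) / of_nat m = of_nat k / of_nat m + (of_nat (n + 1) :: complex)"
    by (simp only: of_nat_add of_nat_mult)
  show ?case
    by (simp only: degenerate_delta.simps degenerate_X_single Suc)
       (simp only: eq, auto intro!: poly_mapping_eqI
          simp: lookup_minus lookup_add lookup_single when_def fun_eq_iff algebra_simps)
qed

lemma degenerate_gen_add:
  "degenerate_gen m \<omega> x (a + b) = degenerate_gen m \<omega> x a + degenerate_gen m \<omega> x b"
  by (cases x) (auto simp: degenerate_X_add degenerate_Y_add degenerate_delta_add)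

lemma degenerate_gen_zero: "degenerate_gen m \<omega> x 0 = 0"
  using degenerate_gen_add[of m \<omega> x 0 0] by simp

lemma h1_module_degenerate:
  assumes m: "m > 0"
  shows "h1_module crossed_scale (degenerate_gen m \<omega>)"
proof -
  note single = degenerate_X_single degenerate_Y_single degenerate_delta_single[OF m] crossed_scale_single
  have scale: "degenerate_gen m \<omega> x (crossed_scale c a) = crossed_scale c (degenerate_gen m \<omega> x a)" for x c a
  proof (induction a rule: poly_mapping_single_induct)
    case zero
    show ?case by (simp add: degenerate_gen_zero module.scale_zero_right[OF module_crossed])
  next
    case (single_add k f p)
    then show ?case
      by (cases k; cases x)
         (auto simp: module.scale_right_distrib[OF module_crossed] degenerate_X_add degenerate_Y_add
           degenerate_delta_add single mult_ac)
  qed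
  have YX: "degenerate_gen m \<omega> genY (degenerate_gen m \<omega> genX a) - degenerate_gen m \<omega> genX (degenerate_gen m \<omega> genY a) =
      degenerate_gen m \<omega> genX a" for a
  proof (induction a rule: poly_mapping_single_induct)
    case (single_add k f p)
    obtain l g where k: "k = (l, g)" by (cases k)
    have "degenerate_gen m \<omega> genY (degenerate_gen m \<omega> genX (Poly_Mapping.single k f)) -
        degenerate_gen m \<omega> genX (degenerate_gen m \<omega> genY (Poly_Mapping.single k f)) =
        degenerate_gen m \<omega> genX (Poly_Mapping.single k f)"
      using m by (auto intro!: poly_mapping_eqI
          simp: k single lookup_minus lookup_add lookup_single when_def fun_eq_iff field_simps)
    with single_add show ?case by (simp only: degenerate_gen_add) (simp add: algebra_simps)
  qed (simp add: degenerate_gen_zero del: degenerate_gen.simps)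
  have YD: "degenerate_gen m \<omega> genY (degenerate_gen m \<omega> (genD n) a) - degenerate_gen m \<omega> (genD n) (degenerate_gen m \<omega> genY a) =
      crossed_scale (of_nat (n + 1)) (degenerate_gen m \<omega> (genD n) a)" for n a
  proof (induction a rule: poly_mapping_single_induct)
    case (single_add k f p)
    obtain l g where k: "k = (l, g)" by (cases k)
    have "degenerate_gen m \<omega> genY (degenerate_gen m \<omega> (genD n) (Poly_Mapping.single k f)) -
        degenerate_gen m \<omega> (genD n) (degenerate_gen m \<omega> genY (Poly_Mapping.single k f)) =
        crossed_scale (of_nat (n + 1)) (degenerate_gen m \<omega> (genD n) (Poly_Mapping.single k f))"
      using m by (auto intro!: poly_mapping_eqI
          simp: k single lookup_minus lookup_add lookup_single when_def fun_eq_iff field_simps)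
    with single_add show ?case
      by (simp only: degenerate_gen_add module.scale_right_distrib[OF module_crossed])
         (simp add: algebra_simps)
  qed (simp add: degenerate_gen_zero module.scale_zero_right[OF module_crossed] del: degenerate_gen.simps)
  have DD: "degenerate_gen m \<omega> (genD i) (degenerate_gen m \<omega> (genD j) a) =
      degenerate_gen m \<omega> (genD j) (degenerate_gen m \<omega> (genD i) a)" for i j a
  proof (induction a rule: poly_mapping_single_induct)
    case (single_add k f p)
    obtain l g where k: "k = (l, g)" by (cases k)
    have "degenerate_gen m \<omega> (genD i) (degenerate_gen m \<omega> (genD j) (Poly_Mapping.single k f)) =
        degenerate_gen m \<omega> (genD j) (degenerate_gen m \<omega> (genD i) (Poly_Mapping.single k f))"
      by (simp add: k single add_ac mult_ac)
    with single_add show ?case by (simp only: degenerate_gen_add)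
  qed (simp add: degenerate_gen_zero del: degenerate_gen.simps)
  show ?thesis
    unfolding h1_module_def
  proof (intro conjI allI)
    show "module_hom crossed_scale crossed_scale (degenerate_gen m \<omega> x)" for x
      by (intro module_hom.intro module_crossed, unfold_locales)
         (auto simp: degenerate_gen_add scale)
    show "degenerate_gen m \<omega> genX (degenerate_gen m \<omega> (genD n) v) - degenerate_gen m \<omega> (genD n) (degenerate_gen m \<omega> genX v) =
        degenerate_gen m \<omega> (genD (Suc n)) v" for n v by simp
  qed (use YX YD DD module_crossed in blast)+
qed

lemma degenerate_action_mult:
  "m > 0 \<Longrightarrow> degenerate_action m \<omega> (h * k) a = degenerate_action m \<omega> h (degenerate_action m \<omega> k a)"
  unfolding degenerate_action_def by (rule h1_act_mult[OF h1_module_degenerate])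

lemma degenerate_action_add:
  "m > 0 \<Longrightarrow> degenerate_action m \<omega> (h + k) a = degenerate_action m \<omega> h a + degenerate_action m \<omega> k a"
  unfolding degenerate_action_def by (rule h1_act_add[OF h1_module_degenerate])

lemma degenerate_action_const:
  "m > 0 \<Longrightarrow> degenerate_action m \<omega> (h1_const c) a = crossed_scale c a"
  unfolding degenerate_action_def by (rule h1_act_const[OF h1_module_degenerate])

lemma degenerate_action_gen:
  "m > 0 \<Longrightarrow> degenerate_action m \<omega> (h1_gen x) a = degenerate_gen m \<omega> x a"
  unfolding degenerate_action_def by (rule h1_act_gen[OF h1_module_degenerate])

lemma degenerate_action_linear:
  "m > 0 \<Longrightarrow> module_hom crossed_scale crossed_scale (degenerate_action m \<omega> h)"
  unfolding degenerate_action_def by (rule h1_act_linear[OF h1_module_degenerate])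


section \<open>Homogeneous polynomials and the cocycles\<close>

text \<open>The polynomial ring \<open>\<complex>[T\<^sub>1, T\<^sub>2]\<close> is the monoid algebra of \<open>\<nat>\<^sup>2\<close>.\<close>

type_synonym poly2 = "(nat \<times> nat) \<Rightarrow>\<^sub>0 complex"

definition T1 :: poly2 where "T1 = Poly_Mapping.single (1, 0) 1"
definition T2 :: poly2 where "T2 = Poly_Mapping.single (0, 1) 1"

definition homogeneous :: "nat \<Rightarrow> poly2 set" where
  "homogeneous n = {P. \<forall>(i, j)\<in>Poly_Mapping.keys P. i + j = n}"

definition poly_act :: "nat \<Rightarrow> real^2^2 \<Rightarrow> poly2 \<Rightarrow> poly2" where
  "poly_act n A P = pconst (of_real (det A powr (- real n / 2))) *
     (\<Sum>(i, j)\<in>Poly_Mapping.keys P. pconst (Poly_Mapping.lookup P (i, j)) *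
        (pconst (of_real (A$1$1)) * T1 + pconst (of_real (A$2$1)) * T2) ^ i *
        (pconst (of_real (A$1$2)) * T1 + pconst (of_real (A$2$2)) * T2) ^ j)"

definition F_poly :: "nat \<Rightarrow> complex \<Rightarrow> poly2" where
  "F_poly n z = (pconst z * T1 + T2) ^ n"

text \<open>The coefficientwise application of an integral \<open>I\<close> to a function with values in the
  homogeneous polynomials of degree \<open>n\<close>.\<close>

definition poly_integral ::
    "nat \<Rightarrow> ((complex \<Rightarrow> complex) \<Rightarrow> complex) \<Rightarrow> (complex \<Rightarrow> poly2) \<Rightarrow> poly2" where
  "poly_integral n I P =
     (\<Sum>j\<le>n. Poly_Mapping.single (j, n - j) (I (\<lambda>z. Poly_Mapping.lookup (P z) (j, n - j))))"

lemma poly_integral_homogeneous: "poly_integral n I P \<in> homogeneous n"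
  unfolding homogeneous_def poly_integral_def
  using keys_sum[of "\<lambda>j. Poly_Mapping.single (j, n - j) (I (\<lambda>z. Poly_Mapping.lookup (P z) (j, n - j)))" "{..n}"]
  by (fastforce split: if_splits)

definition segment_integral :: "complex \<Rightarrow> complex \<Rightarrow> (complex \<Rightarrow> complex) \<Rightarrow> complex" where
  "segment_integral z w = contour_integral (linepath z w)"

definition cusp_integral :: "complex \<Rightarrow> (complex \<Rightarrow> complex) \<Rightarrow> complex" where
  "cusp_integral z f = integral {0..} (\<lambda>t. f (z + \<i> * of_real t) * \<i>)"

definition F_check :: "nat \<Rightarrow> complex \<Rightarrow> poly2" where
  "F_check n z = poly_integral n (segment_integral 0 z) (F_poly n)"

definition tau_term :: "nat \<Rightarrow> complex \<Rightarrow> gl2q \<Rightarrow> (complex \<Rightarrow> complex) \<Rightarrow> poly2" where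
  "tau_term m z0 \<gamma> g =
     poly_integral (m - 2) (segment_integral z0 (mobius (mat_of \<gamma>) z0))
       (\<lambda>z. F_poly (m - 2) z * pconst (g z))"

definition tau_tilde_term :: "nat \<Rightarrow> complex \<Rightarrow> gl2q \<Rightarrow> (complex \<Rightarrow> complex) \<Rightarrow> poly2" where
  "tau_tilde_term m z0 \<gamma> g =
     (let n = m - 2; A = mat_of \<gamma>; g' = slash m g A in
      poly_integral n (segment_integral z0 (mobius A z0)) (\<lambda>z. F_poly n z * pconst (g z))
      + F_check n z0 * pconst (const_coeff g)
      - poly_act n A (F_check n z0) * pconst (const_coeff g')
      - poly_integral n (cusp_integral z0) (\<lambda>z. F_poly n z * pconst (g z - const_coeff g))
      + poly_integral n (cusp_integral z0)
          (\<lambda>z. poly_act n A (F_poly n z) * pconst (g' z - const_coeff g')))"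

definition crossed_pairing ::
    "nat \<Rightarrow> (gl2q \<Rightarrow> (complex \<Rightarrow> complex) \<Rightarrow> poly2) \<Rightarrow> crossed \<Rightarrow> crossed \<Rightarrow> poly2" where
  "crossed_pairing m C a0 a1 =
     pm_extend (\<lambda>(k0, \<gamma>0) f0.
       pm_extend (\<lambda>(k1, \<gamma>1) f1.
         if k0 + k1 = m \<and> \<gamma>0 * \<gamma>1 = 1 then C \<gamma>0 (f0 * slash k1 f1 (mat_of \<gamma>1)) else 0) a1) a0"

definition tau :: "nat \<Rightarrow> complex \<Rightarrow> crossed \<Rightarrow> crossed \<Rightarrow> poly2" where
  "tau m z0 = crossed_pairing m (tau_term m z0)"

definition tau_tilde :: "nat \<Rightarrow> complex \<Rightarrow> crossed \<Rightarrow> crossed \<Rightarrow> poly2" where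
  "tau_tilde m z0 = crossed_pairing m (tau_tilde_term m z0)"


end

theory Submission
  imports Defs
begin

text \<open>
  Both cocycles have the shape \<open>\<tau>(f\<^sup>0 U\<^sub>\<alpha>, f\<^sup>1 U\<^sub>\<beta>) = C\<^sub>\<alpha>(f\<^sup>0 \<cdot> f\<^sup>1|\<beta>)\<close> if the weights add up to
  \<open>m\<close> and \<open>\<alpha>\<beta> = 1\<close>, and zero otherwise, where \<open>C\<^sub>\<alpha>\<close> is linear. Every
  pairing of this shape is invariant. For \<open>Y\<close> this says
  that the two weights add up to \<open>m\<close> (\<open>invariant_Y\<close>). For \<open>X\<close>, the operators raise the total weight by
  \<open>m\<close>, so only arguments of weight 0 could contribute, and on these the factor \<open>Y\<close> vanishes
  (\<open>invariant_X\<close>). For \<open>\<delta>\<^sub>1\<close>, the two integrands cancel pointwise because \<open>\<delta>\<^sub>1\<close> is the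
  commutator with \<open>\<omega>\<close> (\<open>T_delta_cancel\<close>). The elements satisfying the invariance form a
  subalgebra, because the coproduct and the character are multiplicative (\<open>invariant_mult\<close>), and
  these three elements generate the algebra.

  Two points need care. First, evaluating \<open>\<tau>(h\<^sub>1 a, h\<^sub>2 b)\<close> on an arbitrary representation of a
  coproduct requires a well-defined map on \<open>H\<^sub>1 \<otimes> H\<^sub>1\<close>. The bilinear extension to formal
  combinations of pairs kills the ideal that defines the tensor square (\<open>pair_apply_ideal\<close>).

  Second, the integrals are linear only where they converge, so one needs a space of coefficients
  that is stable under all operations involved and on which they do. The space
  \<open>cusp_regular k\<close> of functions all of whose translates under \<open>GL\<^sup>+(2,\<rat>)\<close> have expansions in powers
  of \<open>exp (2\<pi>i z / N)\<close> for some \<open>N\<close> serves: it contains the modular forms of weight \<open>k\<close>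
  (\<open>modular_forms_cusp_regular\<close>), constant coefficients are well defined and linear on it, and after
  subtraction of the constant coefficient a function decays exponentially towards the cusp
  (\<open>q_expansion_decay\<close>), so its integral against any polynomial converges.
\<close>

section \<open>The slash action on the upper half-plane\<close>

text \<open>Since \<open>x / 0 = 0\<close>, the formula has no exceptional points, which is what makes
  \<open>slash_vanishes_below\<close> work for functions extended by zero.\<close>

lemma Im_mobius:
  fixes A :: "real^2^2"
  shows "Im (mobius A z) = det A * Im z / (cmod (of_real (A$2$1) * z + of_real (A$2$2)))\<^sup>2"
  unfolding mobius_def Im_divide cmod_power2 det_2 by (simp add: algebra_simps)

lemma Im_mobius_pos:
  fixes A :: "real^2^2"
  shows "0 < det A \<Longrightarrow> 0 < Im z \<Longrightarrow> 0 < Im (mobius A z)"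
proof -
  assume A: "0 < det A" and z: "0 < Im z"
  have "of_real (A$2$1) * z + of_real (A$2$2) \<noteq> 0"
  proof
    assume *: "of_real (A$2$1) * z + of_real (A$2$2) = 0"
    have "Im (of_real (A$2$1) * z + of_real (A$2$2)) = 0" "Re (of_real (A$2$1) * z + of_real (A$2$2)) = 0"
      unfolding * by simp_all
    then have "A$2$1 * Im z = 0" "A$2$1 * Re z + A$2$2 = 0" by simp_all
    with z A show False by (auto simp: det_2)
  qed
  then show ?thesis using A z unfolding Im_mobius by simp
qed

lemma automorphy_factor_nonzero:
  fixes A :: "real^2^2"
  assumes "0 < det A" "0 < Im z"
  shows "of_real (A$2$1) * z + of_real (A$2$2) \<noteq> 0"
  using Im_mobius_pos[OF assms] by (auto simp: mobius_def)

lemma slash_slash: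
  fixes A B :: "real^2^2"
  assumes A: "0 < det A" and B: "0 < det B" and z: "0 < Im z"
  shows "slash k (slash k f A) B z = slash k f (A ** B) z"
proof -
  define w where "w = of_real (B$1$1) * z + of_real (B$1$2)"
  define v where "v = of_real (B$2$1) * z + of_real (B$2$2)"
  define v' where "v' = of_real ((A ** B)$2$1) * z + of_real ((A ** B)$2$2)"
  have v: "v \<noteq> 0" unfolding v_def by (rule automorphy_factor_nonzero[OF B z])
  have m: "mobius B z = w / v" by (simp add: mobius_def w_def v_def)
  have den: "of_real (A$2$1) * (w / v) + of_real (A$2$2) = v' / v"
    using v by (simp add: field_simps v'_def)
       (simp add: w_def v_def matrix_matrix_mult_def sum_2 algebra_simps)
  have num: "of_real (A$1$1) * (w / v) + of_real (A$1$2) =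
      (of_real ((A ** B)$1$1) * z + of_real ((A ** B)$1$2)) / v"
    using v by (simp add: field_simps)
       (simp add: w_def v_def matrix_matrix_mult_def sum_2 algebra_simps)
  have mm: "mobius A (mobius B z) = mobius (A ** B) z"
    unfolding m mobius_def[of A] den num mobius_def[of "A ** B"] using v
    by (simp add: v'_def)
  have "det (A ** B) powr (real k / 2) = det B powr (real k / 2) * det A powr (real k / 2)"
    using A B by (simp add: det_mul powr_mult mult.commute)
  then show ?thesis
    unfolding slash_def mm unfolding m den v_def[symmetric] v'_def[symmetric]
    using v by (simp add: power_divide)
qed

lemma slash_mult: "slash (k + l) (f * g) A = slash k f A * slash l g A" if "0 < det A"
proof -
  have "det A powr (real (k + l) / 2) = det A powr (real k / 2) * det A powr (real l / 2)"
    using that by (simp add: powr_add[symmetric] add_divide_distrib)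
  then show ?thesis by (simp add: fun_eq_iff slash_def power_add)
qed

lemma slash_vanishes_below:
  assumes "0 < det A" "\<And>z. Im z \<le> 0 \<Longrightarrow> f z = 0" "Im z \<le> 0"
  shows "slash k f A z = 0"
proof -
  have "Im (mobius A z) \<le> 0"
    unfolding Im_mobius using assms(1,3)
    by (intro divide_nonpos_nonneg mult_nonneg_nonpos) auto
  then show ?thesis using assms(2) by (simp add: slash_def)
qed

lemma det_mat_of: "0 < det (mat_of \<gamma>)"
  using mat_of[of \<gamma>] by simp


section \<open>Expansions at the cusp\<close>

lemma has_q_expansion_iff_power_series:
  "has_q_expansion N f a \<longleftrightarrow>
     (\<forall>z. Im z > 0 \<longrightarrow> (\<lambda>n. a n * exp (2 * of_real pi * \<i> * z / of_nat N) ^ n) sums f z)"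
  unfolding has_q_expansion_def by (simp add: exp_of_nat_mult[symmetric] mult_ac)

lemma has_q_expansion_sums:
  "has_q_expansion N f a \<Longrightarrow> Im z > 0 \<Longrightarrow>
     (\<lambda>n. a n * exp (2 * of_real pi * \<i> * z / of_nat N) ^ n) sums f z"
  by (simp add: has_q_expansion_iff_power_series)

lemma has_q_expansion_cong:
  "has_q_expansion N f a \<Longrightarrow> (\<And>z. Im z > 0 \<Longrightarrow> f z = g z) \<Longrightarrow> has_q_expansion N g a"
  by (simp add: has_q_expansion_def)

lemma norm_nome:
  "norm (exp (2 * of_real pi * \<i> * z / of_nat N)) = exp (- 2 * pi * Im z / real N)"
  by (simp add: norm_exp_eq_Re Re_divide_of_nat)

text \<open>Convergence on the whole upper half-plane means convergence at nomes of every modulus below 1, so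
  at any \<open>q\<close> in the open disc a convergent point of larger modulus is available and the power series
  converges absolutely.\<close>

lemma summable_norm_q_expansion:
  assumes f: "has_q_expansion N f a" and N: "N \<ge> 1" and q: "norm q < 1"
  shows "summable (\<lambda>n. norm (a n * q ^ n))"
proof -
  \<comment> \<open>For \<open>q \<noteq> 0\<close> the nome of \<open>i y\<close> has modulus \<open>\<bar>q\<bar>\<^sup>1\<^sup>/\<^sup>2\<close>, strictly between \<open>\<bar>q\<bar>\<close> and 1.\<close>
  define y where "y = (if q = 0 then 1 else - real N * ln (norm q) / (4 * pi))"
  have y: "y > 0"
    using q N by (auto simp: y_def zero_less_mult_iff divide_less_0_iff mult_less_0_iff)
  let ?x = "exp (2 * of_real pi * \<i> * (\<i> * of_real y) / of_nat N) :: complex"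
  have "norm q < norm ?x"
  proof (cases "q = 0")
    case False
    have "norm ?x = exp (ln (norm q) / 2)"
      unfolding norm_nome using N False by (simp add: y_def field_simps)
    also have "\<dots> > exp (ln (norm q))"
      unfolding exp_less_cancel_iff using ln_less_zero[of "norm q"] False q by simp
    finally show ?thesis using False by simp
  qed simp
  moreover have "summable (\<lambda>n. a n * ?x ^ n)"
    using has_q_expansion_sums[OF f, of "\<i> * of_real y"] y by (auto simp: sums_iff)
  ultimately show ?thesis by (rule powser_insidea[rotated])
qed

lemma has_q_expansion_imp_continuous:
  assumes f: "has_q_expansion N f a" and N: "N \<ge> 1"
  shows "continuous_on {z. Im z > 0} f"
proof -
  define \<phi> where "\<phi> = (\<lambda>q. suminf (\<lambda>n. a n * q ^ n))"
  have "(\<lambda>n. a n * (q - 0) ^ n) sums \<phi> q" if "q \<in> ball 0 1" for q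
    using summable_norm_cancel[OF summable_norm_q_expansion[OF f N]] that
    by (simp add: \<phi>_def summable_sums)
  then have "\<phi> holomorphic_on ball 0 1" by (rule power_series_holomorphic)
  then have \<phi>: "continuous_on (ball 0 1) \<phi>" by (rule holomorphic_on_imp_continuous_on)
  have "continuous_on {z. Im z > 0} (\<lambda>z. \<phi> (exp (2 * of_real pi * \<i> * z / of_nat N)))"
    by (rule continuous_on_compose2[OF \<phi>]) (use N in \<open>auto intro!: continuous_intros simp: norm_nome\<close>)
  moreover have "\<phi> (exp (2 * of_real pi * \<i> * z / of_nat N)) = f z" if "Im z > 0" for z
    using has_q_expansion_sums[OF f that] by (simp add: \<phi>_def sums_iff)
  ultimately show ?thesis by (rule continuous_on_eq) simp
qed

text \<open>Everything but the constant term carries a factor \<open>q\<close>, and the remaining series is bounded by its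
  value at height \<open>y0\<close>.\<close>

lemma q_expansion_decay:
  assumes f: "has_q_expansion N f a" and N: "N \<ge> 1" and y0: "y0 > 0"
  shows "\<exists>C. \<forall>z. Im z \<ge> y0 \<longrightarrow> norm (f z - a 0) \<le> C * exp (- 2 * pi * Im z / real N)"
proof (intro exI allI impI)
  define r where "r = exp (- 2 * pi * y0 / real N)"
  fix z assume z: "Im z \<ge> y0"
  let ?q = "exp (2 * of_real pi * \<i> * z / of_nat N) :: complex"
  have r: "0 < r" "r < 1" using N y0 by (auto simp: r_def)
  have "norm ?q \<le> r"
    unfolding norm_nome r_def using N z by (simp add: field_simps)
  have "summable (\<lambda>n. norm (a n * of_real r ^ n))"
    by (rule summable_norm_q_expansion[OF f N]) (use r in simp)
  then have "summable (\<lambda>n. norm (a (Suc n) * of_real r ^ Suc n))"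
    by (subst summable_Suc_iff)
  then have "summable (\<lambda>n. norm (a (Suc n) * of_real r ^ Suc n) / r)"
    by (rule summable_divide)
  then have s: "summable (\<lambda>n. norm (a (Suc n)) * r ^ n)"
    using r by (simp add: norm_mult norm_power)
  have "(\<lambda>n. a (Suc n) * ?q ^ Suc n) sums (f z - a 0)"
    using has_q_expansion_sums[OF f, of z] z y0
    by (subst sums_Suc_iff) simp
  then have eq: "f z - a 0 = suminf (\<lambda>n. a (Suc n) * ?q ^ Suc n)" by (simp add: sums_iff)
  have bound: "norm (a (Suc n) * ?q ^ Suc n) \<le> norm ?q * (norm (a (Suc n)) * r ^ n)" for n
  proof -
    have "norm (a (Suc n) * ?q ^ Suc n) = norm ?q * (norm (a (Suc n)) * norm ?q ^ n)"
      by (simp only: norm_mult norm_power power_Suc mult_ac)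
    also have "\<dots> \<le> norm ?q * (norm (a (Suc n)) * r ^ n)"
      by (intro mult_left_mono power_mono \<open>norm ?q \<le> r\<close>) auto
    finally show ?thesis .
  qed
  have "norm (f z - a 0) \<le> suminf (\<lambda>n. norm ?q * (norm (a (Suc n)) * r ^ n))"
    unfolding eq by (rule norm_suminf_le[OF bound summable_mult[OF s]])
  also have "\<dots> = suminf (\<lambda>n. norm (a (Suc n)) * r ^ n) * exp (- 2 * pi * Im z / real N)"
    unfolding suminf_mult[OF s] norm_nome by (rule mult.commute)
  finally show "norm (f z - a 0) \<le>
    suminf (\<lambda>n. norm (a (Suc n)) * exp (- 2 * pi * y0 / real N) ^ n) * exp (- 2 * pi * Im z / real N)"
    by (simp add: r_def)
qed

lemma q_expansion_tendsto_const_coeff: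
  assumes f: "has_q_expansion N f a" and N: "N \<ge> 1"
  shows "((\<lambda>y. f (\<i> * of_real y)) \<longlongrightarrow> a 0) at_top"
proof -
  obtain C where C: "\<And>z. Im z \<ge> 1 \<Longrightarrow> norm (f z - a 0) \<le> C * exp (- 2 * pi * Im z / real N)"
    using q_expansion_decay[OF f N, of 1] by auto
  have lim: "((\<lambda>y. C * exp (- 2 * pi * y / real N)) \<longlongrightarrow> 0) at_top"
  proof -
    have "filterlim (\<lambda>y. (2 * pi / real N) * y) at_top at_top"
      using N by (intro filterlim_tendsto_pos_mult_at_top[OF tendsto_const] filterlim_ident) auto
    then have "filterlim (\<lambda>y. - ((2 * pi / real N) * y)) at_bot at_top"
      by (simp add: filterlim_uminus_at_bot)
    then have "((\<lambda>y. exp (- ((2 * pi / real N) * y))) \<longlongrightarrow> 0) at_top"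
      by (rule filterlim_compose[OF exp_at_bot])
    from tendsto_mult_right_zero[OF this, of C] show ?thesis by simp
  qed
  have "((\<lambda>y. f (\<i> * of_real y) - a 0) \<longlongrightarrow> 0) at_top"
    by (rule Lim_null_comparison[OF _ lim])
       (use C[of "\<i> * of_real y" for y] in \<open>auto intro!: eventually_at_top_linorderI[of 1]\<close>)
  then show ?thesis by (rule LIM_zero_cancel)
qed

text \<open>The constant coefficient is the limit along the imaginary axis, so it depends neither on the level
  nor on the choice of the coefficients.\<close>

lemma const_coeff_eqI:
  assumes "has_q_expansion N f a" "N \<ge> 1"
  shows "const_coeff f = a 0"
  unfolding const_coeff_def
proof (rule the_equality)
  fix c assume "\<exists>N a. N \<ge> 1 \<and> has_q_expansion N f a \<and> a 0 = c"
  then show "c = a 0"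
    using q_expansion_tendsto_const_coeff assms
    by (metis tendsto_unique trivial_limit_at_top_linorder)
qed (use assms in blast)

lemma has_q_expansion_lincomb:
  assumes "has_q_expansion N f a" "has_q_expansion N g b"
  shows "has_q_expansion N (\<lambda>z. c * f z + d * g z) (\<lambda>n. c * a n + d * b n)"
  unfolding has_q_expansion_iff_power_series
proof (intro allI impI)
  fix z :: complex assume z: "Im z > 0"
  let ?q = "exp (2 * of_real pi * \<i> * z / of_nat N) :: complex"
  have "(\<lambda>n. c * (a n * ?q ^ n) + d * (b n * ?q ^ n)) sums (c * f z + d * g z)"
    by (intro sums_add sums_mult has_q_expansion_sums assms z)
  then show "(\<lambda>n. (c * a n + d * b n) * ?q ^ n) sums (c * f z + d * g z)"
    by (simp add: algebra_simps)
qed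

lemma has_q_expansion_mult:
  assumes f: "has_q_expansion N f a" and g: "has_q_expansion N g b" and N: "N \<ge> 1"
  shows "has_q_expansion N (\<lambda>z. f z * g z) (\<lambda>n. \<Sum>i\<le>n. a i * b (n - i))"
  unfolding has_q_expansion_iff_power_series
proof (intro allI impI)
  fix z :: complex assume z: "Im z > 0"
  let ?q = "exp (2 * of_real pi * \<i> * z / of_nat N) :: complex"
  have q: "norm ?q < 1" unfolding norm_nome using z N by simp
  have "(\<lambda>n. \<Sum>i\<le>n. (a i * ?q ^ i) * (b (n - i) * ?q ^ (n - i))) sums (f z * g z)"
    using Cauchy_product_sums[OF summable_norm_q_expansion[OF f N q] summable_norm_q_expansion[OF g N q]]
      has_q_expansion_sums[OF f z] has_q_expansion_sums[OF g z]
    by (simp add: sums_iff)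
  moreover have "(\<Sum>i\<le>n. (a i * ?q ^ i) * (b (n - i) * ?q ^ (n - i))) = (\<Sum>i\<le>n. a i * b (n - i)) * ?q ^ n" for n
    unfolding sum_distrib_right by (intro sum.cong) (auto simp flip: power_add)
  ultimately show "(\<lambda>n. (\<Sum>i\<le>n. a i * b (n - i)) * ?q ^ n) sums (f z * g z)" by simp
qed

text \<open>With \<open>p = q\<close> and \<open>r = 0\<close> this raises the level; in general it is the effect of the
  upper triangular matrices of \<open>GL\<^sup>+(2,\<rat>)\<close>. Substitution turns the \<open>n\<close>-th term of level \<open>N\<close> into
  the \<open>p n\<close>-th term of level \<open>N q\<close>, times a constant of modulus 1 coming from the translation.\<close>

lemma has_q_expansion_affine:
  assumes f: "has_q_expansion N f a" and p: "p \<ge> 1" and q: "q \<ge> 1"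
  shows "\<exists>b. has_q_expansion (N * q) (\<lambda>z. f (of_nat p / of_nat q * z + of_real r)) b"
proof
  let ?b = "\<lambda>n. if p dvd n then a (n div p) * exp (2 * of_real pi * \<i> * of_nat (n div p) * of_real r / of_nat N) else 0"
  show "has_q_expansion (N * q) (\<lambda>z. f (of_nat p / of_nat q * z + of_real r)) ?b"
    unfolding has_q_expansion_def
  proof (intro allI impI)
    fix z :: complex assume z: "Im z > 0"
    let ?t = "\<lambda>n. ?b n * exp (2 * of_real pi * \<i> * of_nat n * z / of_nat (N * q))"
    let ?w = "of_nat p / of_nat q * z + of_real r"
    have "Im ?w = real p / real q * Im z"
      using of_real_divide[of "real p" "real q", where 'a = complex]
      by (simp del: of_real_divide)
    then have "Im ?w > 0" using p q z by simp
    then have "(\<lambda>n. a n * exp (2 * of_real pi * \<i> * of_nat n * ?w / of_nat N)) sums f ?w"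
      using f by (simp only: has_q_expansion_def)
    moreover have "?t (p * n) = a n * exp (2 * of_real pi * \<i> * of_nat n * ?w / of_nat N)" for n
    proof -
      have "?t (p * n) = a n * exp (2 * of_real pi * \<i> * of_nat n * of_real r / of_nat N +
          2 * of_real pi * \<i> * of_nat (p * n) * z / of_nat (N * q))"
        using p by (simp add: exp_add)
      also have "2 * of_real pi * \<i> * of_nat n * of_real r / of_nat N +
          2 * of_real pi * \<i> * of_nat (p * n) * z / of_nat (N * q) =
          2 * of_real pi * \<i> * of_nat n * ?w / (of_nat N :: complex)"
        by (simp add: distrib_left add_divide_distrib mult_ac)
      finally show ?thesis .
    qed
    ultimately have "(\<lambda>n. ?t (p * n)) sums f ?w" by simp
    moreover have "strict_mono (\<lambda>n. p * n)" using p by (auto simp: strict_mono_def)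
    moreover have "?t n = 0" if "n \<notin> range (\<lambda>n. p * n)" for n
      using that by (auto simp: dvd_def)
    ultimately show "?t sums f ?w"
      using sums_mono_reindex[of "\<lambda>n. p * n" ?t "f ?w"] by blast
  qed
qed

text \<open>The level is left open so that forms of different levels can be added and multiplied.\<close>

definition q_expandable :: "(complex \<Rightarrow> complex) \<Rightarrow> bool" where
  "q_expandable f \<longleftrightarrow> (\<exists>N\<ge>1. \<exists>a. has_q_expansion N f a)"

lemma q_expandable_cong:
  "q_expandable f \<Longrightarrow> (\<And>z. Im z > 0 \<Longrightarrow> f z = g z) \<Longrightarrow> q_expandable g"
  unfolding q_expandable_def using has_q_expansion_cong by blast

lemma common_level:
  assumes "q_expandable f" "q_expandable g"
  obtains N a b where "N \<ge> 1" "has_q_expansion N f a" "has_q_expansion N g b"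
proof -
  obtain M L a b where M: "M \<ge> 1" "has_q_expansion M f a" and L: "L \<ge> 1" "has_q_expansion L g b"
    using assms by (auto simp: q_expandable_def)
  from has_q_expansion_affine[OF M(2) L(1) L(1), of 0]
  obtain a' where "has_q_expansion (M * L) f a'" using L(1) by auto
  moreover from has_q_expansion_affine[OF L(2) M(1) M(1), of 0]
  obtain b' where "has_q_expansion (M * L) g b'" using M(1) by (auto simp: mult.commute)
  ultimately show ?thesis using that[of "M * L"] M L by simp
qed

lemma q_expandable_lincomb:
  assumes "q_expandable f" "q_expandable g"
  shows "q_expandable (\<lambda>z. c * f z + d * g z)"
proof (rule common_level[OF assms])
  fix N a b assume N: "N \<ge> 1" and f: "has_q_expansion N f a" and g: "has_q_expansion N g b"
  show ?thesis
    unfolding q_expandable_def using N has_q_expansion_lincomb[OF f g] by blast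
qed

lemma const_coeff_lincomb:
  assumes "q_expandable f" "q_expandable g"
  shows "const_coeff (\<lambda>z. c * f z + d * g z) = c * const_coeff f + d * const_coeff g"
proof (rule common_level[OF assms])
  fix N a b assume N: "N \<ge> 1" and f: "has_q_expansion N f a" and g: "has_q_expansion N g b"
  show ?thesis
    by (simp only: const_coeff_eqI[OF f N] const_coeff_eqI[OF g N]
      const_coeff_eqI[OF has_q_expansion_lincomb[OF f g] N])
qed

lemma q_expandable_mult:
  assumes "q_expandable f" "q_expandable g"
  shows "q_expandable (f * g)"
proof (rule common_level[OF assms])
  fix N a b assume N: "N \<ge> 1" and f: "has_q_expansion N f a" and g: "has_q_expansion N g b"
  show ?thesis
    unfolding q_expandable_def times_fun_def using N has_q_expansion_mult[OF f g N] by blast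
qed

lemma q_expandable_continuous: "q_expandable f \<Longrightarrow> continuous_on {z. Im z > 0} f"
  by (auto simp: q_expandable_def intro: has_q_expansion_imp_continuous)

lemma q_expandable_decay:
  assumes "q_expandable f" "y0 > 0"
  shows "\<exists>C. \<exists>c>0. \<forall>z. Im z \<ge> y0 \<longrightarrow> norm (f z - const_coeff f) \<le> C * exp (- c * Im z)"
proof -
  obtain N a where N: "N \<ge> 1" and f: "has_q_expansion N f a"
    using assms(1) by (auto simp: q_expandable_def)
  obtain C where "\<forall>z. Im z \<ge> y0 \<longrightarrow> norm (f z - const_coeff f) \<le> C * exp (- (2 * pi / real N) * Im z)"
    using q_expansion_decay[OF f N assms(2)] unfolding const_coeff_eqI[OF f N] by auto
  then show ?thesis using N by (intro exI[of _ C] exI[of _ "2 * pi / real N"]) auto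
qed


section \<open>Functions regular at all cusps\<close>

text \<open>A space containing the modular forms of weight \<open>k\<close> on which the integrals are linear. Quantifying over
  all translates under \<open>GL\<^sup>+(2,\<rat>)\<close> makes it stable under the slash action by definition, with no
  need to find a congruence subgroup that fixes \<open>f|\<gamma>\<close>. Vanishing off the half-plane makes identities between translates hold as
  identities of functions.\<close>

definition cusp_regular :: "nat \<Rightarrow> (complex \<Rightarrow> complex) set" where
  "cusp_regular k =
     {f. (\<forall>z. Im z \<le> 0 \<longrightarrow> f z = 0) \<and> (\<forall>\<gamma>. q_expandable (slash k f (mat_of \<gamma>)))}"

lemma slash_lincomb:
  "slash k (\<lambda>z. c * f z + d * g z) A = (\<lambda>z. c * slash k f A z + d * slash k g A z)"
  by (simp add: fun_eq_iff slash_def distrib_left add_divide_distrib mult.left_commute)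

lemma cusp_regular_lincomb:
  "f \<in> cusp_regular k \<Longrightarrow> g \<in> cusp_regular k \<Longrightarrow> (\<lambda>z. c * f z + d * g z) \<in> cusp_regular k"
  by (simp add: cusp_regular_def slash_lincomb q_expandable_lincomb)

lemma q_expandable_zero: "q_expandable (\<lambda>_. 0)"
  unfolding q_expandable_def has_q_expansion_def by (intro exI[of _ 1] conjI exI[of _ "\<lambda>_. 0"]) auto

lemma cusp_regular_zero: "0 \<in> cusp_regular k"
  unfolding cusp_regular_def mem_Collect_eq slash_zero using q_expandable_zero by (simp add: zero_fun_def)

lemma cusp_regular_add: "f \<in> cusp_regular k \<Longrightarrow> g \<in> cusp_regular k \<Longrightarrow> f + g \<in> cusp_regular k"
  using cusp_regular_lincomb[of f k g 1 1] by (simp add: plus_fun_def)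

lemma cusp_regular_diff: "f \<in> cusp_regular k \<Longrightarrow> g \<in> cusp_regular k \<Longrightarrow> f - g \<in> cusp_regular k"
  using cusp_regular_lincomb[of f k g 1 "-1"] by (simp add: fun_diff_def)

lemma cusp_regular_scale: "f \<in> cusp_regular k \<Longrightarrow> (\<lambda>z. c * f z) \<in> cusp_regular k"
  using cusp_regular_lincomb[of f k f c 0] by simp

lemma cusp_regular_mult:
  "f \<in> cusp_regular k \<Longrightarrow> g \<in> cusp_regular l \<Longrightarrow> f * g \<in> cusp_regular (k + l)"
  by (simp add: cusp_regular_def slash_mult det_mat_of q_expandable_mult)

lemma cusp_regular_slash:
  assumes f: "f \<in> cusp_regular k"
  shows "slash k f (mat_of \<gamma>) \<in> cusp_regular k"
  unfolding cusp_regular_def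
proof (intro CollectI conjI allI impI)
  fix z :: complex assume "Im z \<le> 0"
  then show "slash k f (mat_of \<gamma>) z = 0"
    using f by (intro slash_vanishes_below det_mat_of) (auto simp: cusp_regular_def)
next
  fix \<gamma>'
  have "q_expandable (slash k f (mat_of (\<gamma> * \<gamma>')))"
    using f by (simp add: cusp_regular_def)
  then show "q_expandable (slash k (slash k f (mat_of \<gamma>)) (mat_of \<gamma>'))"
    by (rule q_expandable_cong) (simp add: slash_slash det_mat_of times_gl2q.rep_eq)
qed

lemma cusp_regular_q_expandable: "f \<in> cusp_regular k \<Longrightarrow> q_expandable f"
  using slash_one[of k f] by (auto simp: cusp_regular_def dest: spec[of _ 1])

text \<open>Clearing denominators and dividing by the gcd leaves a primitive integer vector, and Bezout gives the
  second column of a unimodular matrix.\<close>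

lemma rational_column_proportional_to_coprime:
  assumes "x \<in> \<rat>" "y \<in> \<rat>" "x \<noteq> 0 \<or> y \<noteq> 0"
  obtains t :: real and p q u v :: int
    where "t > 0" "x = t * p" "y = t * q" "u * p + v * q = 1"
proof -
  obtain a b where x: "b > 0" "x = of_int a / of_int b" using assms(1) by (elim Rats_cases') blast
  obtain c d where y: "d > 0" "y = of_int c / of_int d" using assms(2) by (elim Rats_cases') blast
  define e where "e = gcd (a * d) (c * b)"
  have e: "e > 0" using assms(3) x y by (auto simp: e_def)
  obtain u v where uv: "u * (a * d) + v * (c * b) = e"
    using bezout_int[of "a * d" "c * b"] by (auto simp: e_def)
  define p where "p = a * d div e"
  define q where "q = c * b div e"
  have p: "a * d = e * p" and q: "c * b = e * q" by (simp_all add: p_def q_def e_def)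
  have "e * (u * p + v * q) = e * 1"
    using uv unfolding p q by (simp add: algebra_simps)
  then have uvpq: "u * p + v * q = 1" using e by simp
  have xt: "x = real_of_int e / (b * d) * p"
  proof -
    have "x = real_of_int (a * d) / (b * d)" unfolding x(2) using y(1) by simp
    also have "\<dots> = real_of_int e / (b * d) * p" unfolding p by (simp only: of_int_mult times_divide_eq_left)
    finally show ?thesis .
  qed
  have yt: "y = real_of_int e / (b * d) * q"
  proof -
    have "y = real_of_int (c * b) / (b * d)" unfolding y(2) using x(1) by simp
    also have "\<dots> = real_of_int e / (b * d) * q" unfolding q by (simp only: of_int_mult times_divide_eq_left)
    finally show ?thesis .
  qed
  have t: "real_of_int e / (b * d) > 0" using e x(1) y(1) by simp
  show ?thesis by (rule that[OF t xt yt uvpq])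
qed

text \<open>The first column of the matrix is a positive multiple of a primitive integer vector, which is the first
  column of some element of \<open>SL\<^sub>2(\<int>)\<close>; dividing by that element on the left leaves an upper
  triangular matrix.\<close>

lemma gl2q_eq_SL2Z_times_upper_triangular:
  obtains P T :: "real^2^2" where "P \<in> principal_congruence 1" "mat_of \<gamma> = P ** T"
    "T$2$1 = 0" "T$1$1 > 0" "T$2$2 > 0" "T$1$1 \<in> \<rat>" "T$2$2 \<in> \<rat>"
proof -
  let ?A = "mat_of \<gamma>"
  have rat: "?A$i$j \<in> \<rat>" for i j using mat_of[of \<gamma>] by simp
  have det: "?A$1$1 * ?A$2$2 - ?A$1$2 * ?A$2$1 > 0"
    using det_mat_of[of \<gamma>] by (simp add: det_2)
  then have "?A$1$1 \<noteq> 0 \<or> ?A$2$1 \<noteq> 0" by auto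
  then obtain t :: real and p q u v :: int
    where t: "t > 0" and pq: "?A$1$1 = t * p" "?A$2$1 = t * q" and "u * p + v * q = 1"
    using rational_column_proportional_to_coprime[OF rat rat] by metis
  then have uv: "real_of_int u * p + real_of_int v * q = 1"
    by (metis of_int_1 of_int_add of_int_mult)
  define P :: "real^2^2" where
    "P = vector [vector [of_int p, of_int (- v)], vector [of_int q, of_int u]]"
  define T :: "real^2^2" where
    "T = vector [vector [t, u * ?A$1$2 + v * ?A$2$2], vector [0, p * ?A$2$2 - q * ?A$1$2]]"
  have P: "P$1$1 = p" "P$1$2 = - v" "P$2$1 = q" "P$2$2 = u"
    and T: "T$1$1 = t" "T$1$2 = u * ?A$1$2 + v * ?A$2$2" "T$2$1 = 0" "T$2$2 = p * ?A$2$2 - q * ?A$1$2"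
    by (simp_all add: P_def T_def)
  have "P \<in> principal_congruence 1"
  proof -
    have "det P = 1" unfolding det_2 P using uv by (simp add: algebra_simps)
    moreover have "\<forall>i j. \<exists>n::int. P$i$j = (mat 1 :: real^2^2)$i$j + real 1 * of_int n"
      unfolding forall_2 P
      by (auto simp: mat_def intro: exI[of _ "p - 1"] exI[of _ "- v"] exI[of _ q] exI[of _ "u - 1"])
    ultimately show ?thesis by (simp add: principal_congruence_def)
  qed
  moreover have "?A = P ** T"
  proof -
    have "?A$1$2 * 1 = p * (u * ?A$1$2 + v * ?A$2$2) - v * (p * ?A$2$2 - q * ?A$1$2)"
      unfolding uv[symmetric] by (simp add: algebra_simps)
    moreover have "?A$2$2 * 1 = q * (u * ?A$1$2 + v * ?A$2$2) + u * (p * ?A$2$2 - q * ?A$1$2)"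
      unfolding uv[symmetric] by (simp add: algebra_simps)
    ultimately show ?thesis
      unfolding vec_eq_iff forall_2 matrix_matrix_mult_def using pq
      by (simp add: sum_2 P T)
  qed
  moreover have "T$2$2 > 0"
  proof -
    have "t * T$2$2 > 0" using det unfolding pq T by (simp add: algebra_simps)
    then show ?thesis using t by (simp add: zero_less_mult_iff)
  qed
  moreover have "t \<in> \<rat>"
  proof -
    have "t = u * ?A$1$1 + v * ?A$2$1" using uv unfolding pq by algebra
    then show ?thesis using rat by (metis Rats_add Rats_mult Rats_of_int)
  qed
  moreover have "T$2$2 \<in> \<rat>" unfolding T using rat by simp
  ultimately show ?thesis using that t T by metis
qed

text \<open>The definition of modular forms gives the expansions of all translates under \<open>SL\<^sub>2(\<int>)\<close>, and the
  upper triangular factor acts by the substitution \<open>z \<mapsto> (a z + b) / d\<close> and a constant factor.\<close>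

lemma modular_forms_cusp_regular: "modular_forms k \<subseteq> cusp_regular k"
proof
  fix f assume "f \<in> modular_forms k"
  then obtain N where N: "N \<ge> 1" and f: "f \<in> modular_forms_level N k"
    by (auto simp: modular_forms_def)
  show "f \<in> cusp_regular k"
    unfolding cusp_regular_def
  proof (intro CollectI conjI allI impI)
    fix z assume "Im z \<le> 0"
    then show "f z = 0" using f by (simp add: modular_forms_level_def)
  next
    fix \<gamma>
    obtain P T :: "real^2^2" where P: "P \<in> principal_congruence 1" and PT: "mat_of \<gamma> = P ** T"
      and T: "T$2$1 = 0" "T$1$1 > 0" "T$2$2 > 0" and rat: "T$1$1 \<in> \<rat>" "T$2$2 \<in> \<rat>"
      by (rule gl2q_eq_SL2Z_times_upper_triangular)
    let ?g = "slash k f P"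
    obtain a where a: "has_q_expansion N ?g a"
      using f P by (auto simp: modular_forms_level_def)
    obtain p q :: nat where q0: "q \<noteq> 0" and abs: "\<bar>T$1$1 / T$2$2\<bar> = real p / real q"
      using Rats_abs_nat_div_natE[OF Rats_divide[OF rat]] by blast
    have pos: "T$1$1 / T$2$2 > 0" using T by simp
    then have quot: "T$1$1 / T$2$2 = real p / real q" using abs by linarith
    then have "p \<noteq> 0" using pos by (metis div_0 less_irrefl of_nat_0)
    then have pq: "p \<ge> 1" "q \<ge> 1" using q0 by auto
    let ?h = "\<lambda>z. ?g (of_nat p / of_nat q * z + of_real (T$1$2 / T$2$2))"
    have h: "q_expandable ?h"
    proof -
      have "N * q \<ge> 1" using N pq(2) by (simp add: Suc_le_eq)
      then show ?thesis
        using has_q_expansion_affine[OF a pq, of "T$1$2 / T$2$2"] unfolding q_expandable_def by blast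
    qed
    define c :: complex where "c = of_real (det T powr (real k / 2)) / of_real (T$2$2) ^ k"
    have "q_expandable (\<lambda>z. c * ?h z + 0 * ?h z)" by (rule q_expandable_lincomb[OF h h])
    then show "q_expandable (slash k f (mat_of \<gamma>))"
    proof (rule q_expandable_cong)
      fix z :: complex assume z: "Im z > 0"
      have "mobius T z = of_real (T$1$1 / T$2$2) * z + of_real (T$1$2 / T$2$2)"
        unfolding mobius_def using T by (simp add: field_simps)
      also have "of_real (T$1$1 / T$2$2) = (of_nat p / of_nat q :: complex)"
        unfolding quot by simp
      finally have "slash k ?g T z = c * ?h z"
        unfolding slash_def[of k ?g] c_def using T by simp
      moreover have "slash k f (mat_of \<gamma>) z = slash k ?g T z"
        unfolding PT using P T z
        by (subst slash_slash) (auto simp: principal_congruence_def det_2)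
      ultimately show "c * ?h z + 0 * ?h z = slash k f (mat_of \<gamma>) z" by simp
    qed
  qed
qed


section \<open>Linearity of the integrals\<close>

text \<open>The rate is left open: multiplication by a polynomial in \<open>z\<close> preserves the class at the price of a
  smaller rate.\<close>

definition exp_decaying :: "(real \<Rightarrow> complex) \<Rightarrow> bool" where
  "exp_decaying u \<longleftrightarrow>
     continuous_on {0..} u \<and> (\<exists>C c. c > 0 \<and> (\<forall>t\<ge>0. norm (u t) \<le> C * exp (- c * t)))"

lemma exp_decayingI:
  assumes "continuous_on {0..} u" "c > 0" "\<And>t. t \<ge> 0 \<Longrightarrow> norm (u t) \<le> C * exp (- c * t)"
  shows "exp_decaying u"
  unfolding exp_decaying_def
  by (intro conjI exI[of _ C] exI[of _ c] allI impI assms)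

lemma exp_decaying_continuous: "exp_decaying u \<Longrightarrow> continuous_on {0..} u"
  by (simp add: exp_decaying_def)

lemma exp_decaying_integrable:
  assumes "exp_decaying u"
  shows "u integrable_on {0..}"
proof -
  obtain C c where c: "c > 0" and C: "\<And>t. t \<ge> 0 \<Longrightarrow> norm (u t) \<le> C * exp (- c * t)"
    using assms by (auto simp: exp_decaying_def)
  show ?thesis
  proof (rule measurable_bounded_by_integrable_imp_integrable)
    show "u \<in> borel_measurable (lebesgue_on {0..})"
      using assms by (intro continuous_imp_measurable_on_sets_lebesgue) (auto simp: exp_decaying_def)
    show "(\<lambda>t. C * exp (- c * t)) integrable_on {0..}"
      by (intro integrable_on_mult_right integrable_on_exp_minus_to_infinity c)
  qed (use C in auto)
qed

lemma exp_decaying_add: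
  assumes "exp_decaying u" "exp_decaying v"
  shows "exp_decaying (\<lambda>t. u t + v t)"
proof -
  obtain C c where c: "c > 0" and C: "\<And>t. t \<ge> 0 \<Longrightarrow> norm (u t) \<le> C * exp (- c * t)"
    using assms by (auto simp: exp_decaying_def)
  obtain D d where d: "d > 0" and D: "\<And>t. t \<ge> 0 \<Longrightarrow> norm (v t) \<le> D * exp (- d * t)"
    using assms by (auto simp: exp_decaying_def)
  have CD: "C \<ge> 0" "D \<ge> 0" using order_trans[OF norm_ge_zero C[of 0]] order_trans[OF norm_ge_zero D[of 0]] by auto
  have "norm (u t + v t) \<le> (C + D) * exp (- min c d * t)" if "t \<ge> 0" for t
  proof -
    have "norm (u t + v t) \<le> C * exp (- c * t) + D * exp (- d * t)"
      by (rule norm_triangle_le) (use C D that in \<open>auto intro: add_mono\<close>)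
    also have "\<dots> \<le> C * exp (- min c d * t) + D * exp (- min c d * t)"
      using CD that by (intro add_mono mult_left_mono) (auto intro: mult_right_mono)
    finally show ?thesis by (simp add: distrib_right)
  qed
  then show ?thesis
    by (rule exp_decayingI[of _ "min c d" "C + D", rotated 2])
       (use c d in \<open>simp_all add: continuous_on_add exp_decaying_continuous assms\<close>)
qed

lemma exp_decaying_mult_left:
  assumes "exp_decaying u"
  shows "exp_decaying (\<lambda>t. a * u t)"
proof -
  obtain C c where c: "c > 0" and C: "\<And>t. t \<ge> 0 \<Longrightarrow> norm (u t) \<le> C * exp (- c * t)"
    using assms by (auto simp: exp_decaying_def)
  have "norm (a * u t) \<le> (norm a * C) * exp (- c * t)" if "t \<ge> 0" for t
    using mult_left_mono[OF C[OF that], of "norm a"] by (simp add: norm_mult mult_ac)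
  then show ?thesis
    by (rule exp_decayingI[OF continuous_on_mult_left[OF exp_decaying_continuous[OF assms]] c])
qed

lemma exp_decaying_mult_vertical:
  assumes "exp_decaying u"
  shows "exp_decaying (\<lambda>t. (z + \<i> * of_real t) * u t)"
proof -
  obtain C c where c: "c > 0" and C: "\<And>t. t \<ge> 0 \<Longrightarrow> norm (u t) \<le> C * exp (- c * t)"
    using assms by (auto simp: exp_decaying_def)
  have "norm ((z + \<i> * of_real t) * u t) \<le> ((norm z + 2 / c) * C) * exp (- (c / 2) * t)"
    if t: "t \<ge> 0" for t
  proof -
    \<comment> \<open>Half of the exponential decay absorbs the linear growth of the factor.\<close>
    have "c * t / 2 \<le> exp (c * t / 2)" using exp_ge_add_one_self[of "c * t / 2"] by linarith
    then have "2 / c * (c * t / 2) \<le> 2 / c * exp (c * t / 2)"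
      using c by (intro mult_left_mono) auto
    then have "t \<le> 2 / c * exp (c * t / 2)" using c by simp
    moreover have "norm z * 1 \<le> norm z * exp (c * t / 2)"
      using c t by (intro mult_left_mono) auto
    moreover have "norm (z + \<i> * of_real t) \<le> norm z + t"
      using norm_triangle_ineq[of z "\<i> * of_real t"] t by (simp add: norm_mult)
    ultimately have "norm (z + \<i> * of_real t) \<le> (norm z + 2 / c) * exp (c * t / 2)"
      by (simp add: distrib_right)
    then have "norm ((z + \<i> * of_real t) * u t) \<le>
        ((norm z + 2 / c) * exp (c * t / 2)) * (C * exp (- c * t))"
      unfolding norm_mult using C[OF t] by (intro mult_mono) (use c in auto)
    also have "\<dots> = ((norm z + 2 / c) * C) * (exp (c * t / 2) * exp (- c * t))" by simp
    also have "exp (c * t / 2) * exp (- c * t) = exp (- (c / 2) * t)"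
      unfolding exp_add[symmetric] by simp
    finally show ?thesis .
  qed
  then show ?thesis
    by (rule exp_decayingI[of _ "c / 2", rotated 2])
       (use c in \<open>simp_all add: continuous_on_mult continuous_on_add continuous_on_of_real
         exp_decaying_continuous assms\<close>)
qed

lemma exp_decaying_mult_poly:
  assumes "exp_decaying u"
  shows "exp_decaying (\<lambda>t. poly q (z + \<i> * of_real t) * u t)"
proof (induction q)
  case 0
  show ?case using exp_decaying_mult_left[OF assms, of 0] by (simp only: poly_0)
next
  case (pCons a q)
  from exp_decaying_add[OF exp_decaying_mult_left[OF assms, of a] exp_decaying_mult_vertical[OF pCons(2), of z]]
  show ?case by (simp only: poly_pCons distrib_right mult.assoc)
qed

text \<open>Without subtracting the constant coefficient the integrand would not decay towards the cusp.\<close>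

lemma exp_decaying_vertical:
  assumes f: "q_expandable f" and z: "Im z > 0"
  shows "exp_decaying (\<lambda>t. f (z + \<i> * of_real t) - const_coeff f)"
proof -
  obtain C c where c: "c > 0"
    and C: "\<And>w. Im w \<ge> Im z \<Longrightarrow> norm (f w - const_coeff f) \<le> C * exp (- c * Im w)"
    using q_expandable_decay[OF f z] by blast
  have "norm (f (z + \<i> * of_real t) - const_coeff f) \<le> (C * exp (- c * Im z)) * exp (- c * t)"
    if "t \<ge> 0" for t
  proof -
    have "exp (- c * Im (z + \<i> * of_real t)) = exp (- c * Im z) * exp (- c * t)"
      unfolding exp_add[symmetric] by (simp add: algebra_simps)
    then show ?thesis using C[of "z + \<i> * of_real t"] that by (simp add: mult.assoc)
  qed
  moreover have "continuous_on {0..} (\<lambda>t. f (z + \<i> * of_real t) - const_coeff f)"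
    by (rule continuous_on_diff[OF continuous_on_compose2[OF q_expandable_continuous[OF f]] continuous_on_const])
       (use z in \<open>auto intro!: continuous_intros\<close>)
  ultimately show ?thesis
    by (intro exp_decayingI[OF _ c])
qed

lemma cusp_integral_lincomb:
  assumes f: "q_expandable f" and g: "q_expandable g" and z: "Im z > 0"
  shows "cusp_integral z (\<lambda>w. poly q w * (c * (f w - const_coeff f) + d * (g w - const_coeff g))) =
    c * cusp_integral z (\<lambda>w. poly q w * (f w - const_coeff f)) +
    d * cusp_integral z (\<lambda>w. poly q w * (g w - const_coeff g))"
proof -
  let ?I = "\<lambda>f t. poly q (z + \<i> * of_real t) * (f (z + \<i> * of_real t) - const_coeff f) * \<i>"
  have int: "?I f integrable_on {0..}" if "q_expandable f" for f
    by (intro integrable_on_mult_left exp_decaying_integrable exp_decaying_mult_poly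
        exp_decaying_vertical that z)
  have "cusp_integral z (\<lambda>w. poly q w * (c * (f w - const_coeff f) + d * (g w - const_coeff g))) =
      integral {0..} (\<lambda>t. c * ?I f t + d * ?I g t)"
    unfolding cusp_integral_def by (simp add: algebra_simps)
  also have "\<dots> = c * integral {0..} (?I f) + d * integral {0..} (?I g)"
    by (subst integral_add) (auto intro!: integrable_on_mult_right int f g)
  finally show ?thesis by (simp add: cusp_integral_def)
qed

lemma segment_integral_lincomb:
  assumes "continuous_on {z. Im z > 0} f" "continuous_on {z. Im z > 0} g" "Im z > 0" "Im w > 0"
  shows "segment_integral z w (\<lambda>x. poly q x * (c * f x + d * g x)) =
    c * segment_integral z w (\<lambda>x. poly q x * f x) + d * segment_integral z w (\<lambda>x. poly q x * g x)"
proof -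
  have sub: "closed_segment z w \<subseteq> {z. Im z > 0}"
    using assms(3,4) by (intro closed_segment_subset convex_halfspace_Im_gt) auto
  have int: "(\<lambda>x. poly q x * f x) contour_integrable_on linepath z w"
    if "continuous_on {z. Im z > 0} f" for f
    by (intro contour_integrable_continuous_linepath continuous_intros continuous_on_subset[OF that sub])
  have "segment_integral z w (\<lambda>x. poly q x * (c * f x + d * g x)) =
      contour_integral (linepath z w) (\<lambda>x. c * (poly q x * f x) + d * (poly q x * g x))"
    unfolding segment_integral_def by (simp only: distrib_left mult.left_commute)
  also have "\<dots> = contour_integral (linepath z w) (\<lambda>x. c * (poly q x * f x)) +
      contour_integral (linepath z w) (\<lambda>x. d * (poly q x * g x))"
    by (rule contour_integral_add; rule contour_integrable_lmul; rule int; fact)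
  also have "\<dots> = c * contour_integral (linepath z w) (\<lambda>x. poly q x * f x) +
      d * contour_integral (linepath z w) (\<lambda>x. poly q x * g x)"
    by (intro arg_cong2[of _ _ _ _ "(+)"] contour_integral_lmul int assms(1,2))
  finally show ?thesis by (simp only: segment_integral_def)
qed

lemma pconst_add: "pconst (a + b) = pconst a + pconst b"
  by (simp add: pconst_def single_add)

lemma pconst_mult: "pconst (a * b) = pconst a * pconst (b::complex)"
  by (simp add: pconst_def mult_single)

lemma lookup_pconst_mult:
  fixes p :: "'m::monoid_add \<Rightarrow>\<^sub>0 complex"
  shows "Poly_Mapping.lookup (pconst c * p) k = c * Poly_Mapping.lookup p k"
  by (induction p rule: poly_mapping_single_induct)
     (auto simp: pconst_def mult_single distrib_left lookup_add lookup_single when_def)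

lemma lookup_mult_pconst:
  fixes p :: "'m::monoid_add \<Rightarrow>\<^sub>0 complex"
  shows "Poly_Mapping.lookup (p * pconst c) k = Poly_Mapping.lookup p k * c"
  by (simp add: pconst_central[symmetric] lookup_pconst_mult)

text \<open>The coefficients of \<^const>\<open>F_poly\<close> and of its translates are polynomials in \<open>z\<close>, which is the
  form of the weight factors that the scalar integrals can handle.\<close>

definition polynomial_family :: "(complex \<Rightarrow> poly2) \<Rightarrow> bool" where
  "polynomial_family P \<longleftrightarrow> (\<forall>k. \<exists>q. \<forall>z. Poly_Mapping.lookup (P z) k = poly q z)"

lemma polynomial_family_add:
  assumes "polynomial_family P" "polynomial_family Q"
  shows "polynomial_family (\<lambda>z. P z + Q z)"
  using assms unfolding polynomial_family_def lookup_add by (metis poly_add)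

lemma polynomial_family_scaled:
  assumes "polynomial_family P"
  shows "polynomial_family (\<lambda>z. pconst (Poly_Mapping.lookup (P z) k) * Q)"
  unfolding polynomial_family_def lookup_pconst_mult
proof
  fix l
  obtain q where "\<forall>z. Poly_Mapping.lookup (P z) k = poly q z"
    using assms unfolding polynomial_family_def by blast
  then have "\<forall>z. Poly_Mapping.lookup (P z) k * Poly_Mapping.lookup Q l = poly (smult (Poly_Mapping.lookup Q l) q) z"
    by (simp add: mult.commute)
  then show "\<exists>q. \<forall>z. Poly_Mapping.lookup (P z) k * Poly_Mapping.lookup Q l = poly q z" by blast
qed

lemma polynomial_family_sum:
  assumes "finite S" "\<And>i. i \<in> S \<Longrightarrow> polynomial_family (P i)"
  shows "polynomial_family (\<lambda>z. \<Sum>i\<in>S. P i z)"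
  using assms
proof (induction S rule: finite_induct)
  case empty
  have "\<forall>z. Poly_Mapping.lookup 0 k = poly 0 z" for k :: "nat \<times> nat" by simp
  then show ?case unfolding polynomial_family_def sum.empty by blast
next
  case (insert i S)
  then show ?case by (simp add: polynomial_family_add)
qed

lemma F_poly_eq:
  "F_poly n z = (\<Sum>j\<le>n. Poly_Mapping.single (j, n - j) (of_nat (n choose j) * z ^ j))"
proof -
  have one: "(1 :: poly2) = Poly_Mapping.single (0, 0) 1"
    unfolding single_one[symmetric] zero_prod_def ..
  have of_nat: "(of_nat k :: poly2) = Poly_Mapping.single (0, 0) (of_nat k)" for k
    unfolding single_of_nat[symmetric] zero_prod_def ..
  have T1: "pconst z * T1 = Poly_Mapping.single (1, 0) z"
    unfolding pconst_def T1_def mult_single by simp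
  have 1: "(pconst z * T1) ^ j = Poly_Mapping.single (j, 0) (z ^ j)" for j
    by (induction j) (simp_all only: power_0 one power_Suc T1 mult_single add_Pair, simp)
  have 2: "T2 ^ j = Poly_Mapping.single (0, j) 1" for j
    by (induction j) (simp_all only: power_0 one power_Suc T2_def mult_single add_Pair, simp)
  have "F_poly n z = (\<Sum>j\<le>n. of_nat (n choose j) * (pconst z * T1) ^ j * T2 ^ (n - j))"
    unfolding F_poly_def by (rule binomial_ring)
  also have "\<dots> = (\<Sum>j\<le>n. Poly_Mapping.single (j, n - j) (of_nat (n choose j) * z ^ j))"
    unfolding 1 2 of_nat mult_single by simp
  finally show ?thesis .
qed

lemma polynomial_family_F_poly: "polynomial_family (F_poly n)"
  unfolding F_poly_eq
proof (intro polynomial_family_sum)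
  fix j
  have "\<forall>z::complex. Poly_Mapping.lookup (Poly_Mapping.single (j, n - j) (of_nat (n choose j) * z ^ j)) k =
      poly (if k = (j, n - j) then monom (of_nat (n choose j)) j else 0) z" for k
    by (simp add: lookup_single when_def poly_monom)
  then show "polynomial_family (\<lambda>z. Poly_Mapping.single (j, n - j) (of_nat (n choose j) * z ^ j))"
    unfolding polynomial_family_def by blast
qed auto

lemma keys_F_poly: "Poly_Mapping.keys (F_poly n z) \<subseteq> {..n} \<times> {..n}"
  unfolding F_poly_eq
  using keys_sum[of "\<lambda>j. Poly_Mapping.single (j, n - j) (of_nat (n choose j) * z ^ j)" "{..n}"]
  by (fastforce split: if_splits)

lemma polynomial_family_act_F_poly: "polynomial_family (\<lambda>z. poly_act n A (F_poly n z))"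
proof -
  define d where "d = complex_of_real (det A powr (- real n / 2))"
  define M :: "nat \<times> nat \<Rightarrow> poly2" where
    "M = (\<lambda>(i, j). (pconst (of_real (A$1$1)) * T1 + pconst (of_real (A$2$1)) * T2) ^ i *
        (pconst (of_real (A$1$2)) * T1 + pconst (of_real (A$2$2)) * T2) ^ j)"
  have "poly_act n A (F_poly n z) =
      (\<Sum>k\<in>{..n} \<times> {..n}. pconst (Poly_Mapping.lookup (F_poly n z) k) * (pconst d * M k))" for z
  proof -
    have "poly_act n A (F_poly n z) =
      (\<Sum>k\<in>Poly_Mapping.keys (F_poly n z). pconst (Poly_Mapping.lookup (F_poly n z) k) * (pconst d * M k))"
      unfolding poly_act_def sum_distrib_left d_def[symmetric] M_def
      by (intro sum.cong) (auto simp: mult_ac)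
    also have "\<dots> = (\<Sum>k\<in>{..n} \<times> {..n}. pconst (Poly_Mapping.lookup (F_poly n z) k) * (pconst d * M k))"
      by (intro sum.mono_neutral_left keys_F_poly) (auto simp: in_keys_iff pconst_def)
    finally show ?thesis .
  qed
  then show ?thesis
    by (simp only:) (intro polynomial_family_sum polynomial_family_scaled polynomial_family_F_poly; simp)
qed

text \<open>Linearity of the scalar integral against every polynomial weight passes to the polynomial-valued one,
  coefficient by coefficient.\<close>

lemma poly_integral_lincomb:
  assumes P: "polynomial_family P"
    and I: "\<And>q. I (\<lambda>z. poly q z * (c * f z + d * g z)) =
      c * I (\<lambda>z. poly q z * f z) + d * I (\<lambda>z. poly q z * g z)"
  shows "poly_integral n I (\<lambda>z. P z * pconst (c * f z + d * g z)) =
    pconst c * poly_integral n I (\<lambda>z. P z * pconst (f z)) +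
    pconst d * poly_integral n I (\<lambda>z. P z * pconst (g z))"
proof -
  have *: "I (\<lambda>z. Poly_Mapping.lookup (P z) k * (c * f z + d * g z)) =
      c * I (\<lambda>z. Poly_Mapping.lookup (P z) k * f z) + d * I (\<lambda>z. Poly_Mapping.lookup (P z) k * g z)" for k
  proof -
    obtain q where "\<And>z. Poly_Mapping.lookup (P z) k = poly q z"
      using P unfolding polynomial_family_def by blast
    then show ?thesis using I[of q] by simp
  qed
  show ?thesis
    unfolding poly_integral_def lookup_mult_pconst *
    by (simp add: sum_distrib_left flip: sum.distrib)
       (simp add: pconst_def mult_single single_add)
qed

lemma tau_term_lincomb:
  assumes f: "f \<in> cusp_regular m" and g: "g \<in> cusp_regular m" and z0: "Im z0 > 0"
  shows "tau_term m z0 \<gamma> (\<lambda>z. c * f z + d * g z) =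
    pconst c * tau_term m z0 \<gamma> f + pconst d * tau_term m z0 \<gamma> g"
  unfolding tau_term_def
  by (intro poly_integral_lincomb polynomial_family_F_poly segment_integral_lincomb
      q_expandable_continuous[OF cusp_regular_q_expandable[OF f]]
      q_expandable_continuous[OF cusp_regular_q_expandable[OF g]] z0 Im_mobius_pos det_mat_of)

lemma tau_tilde_term_lincomb:
  assumes f: "f \<in> cusp_regular m" and g: "g \<in> cusp_regular m" and z0: "Im z0 > 0"
  shows "tau_tilde_term m z0 \<gamma> (\<lambda>z. c * f z + d * g z) =
    pconst c * tau_tilde_term m z0 \<gamma> f + pconst d * tau_tilde_term m z0 \<gamma> g"
proof -
  have cusp: "poly_integral n (cusp_integral z0)
        (\<lambda>z. P z * pconst (c * f z + d * g z - const_coeff (\<lambda>z. c * f z + d * g z))) =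
      pconst c * poly_integral n (cusp_integral z0) (\<lambda>z. P z * pconst (f z - const_coeff f)) +
      pconst d * poly_integral n (cusp_integral z0) (\<lambda>z. P z * pconst (g z - const_coeff g))"
    if P: "polynomial_family P" and fg: "q_expandable f" "q_expandable g" for n P f g
  proof -
    have "c * f z + d * g z - const_coeff (\<lambda>z. c * f z + d * g z) =
        c * (f z - const_coeff f) + d * (g z - const_coeff g)" for z
      unfolding const_coeff_lincomb[OF fg] by (simp add: algebra_simps)
    then show ?thesis
      by (simp only: poly_integral_lincomb[OF P cusp_integral_lincomb[OF fg z0]])
  qed
  note fg = cusp_regular_q_expandable[OF f] cusp_regular_q_expandable[OF g]
  note fg' = cusp_regular_q_expandable[OF cusp_regular_slash[OF f]] cusp_regular_q_expandable[OF cusp_regular_slash[OF g]]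
  note segment = tau_term_lincomb[OF f g z0, unfolded tau_term_def]
  show ?thesis
    unfolding tau_tilde_term_def Let_def slash_lincomb segment cusp[OF polynomial_family_F_poly fg]
      cusp[OF polynomial_family_act_F_poly fg']
    unfolding const_coeff_lincomb[OF fg] const_coeff_lincomb[OF fg'] pconst_add pconst_mult
    by (simp add: algebra_simps)
qed

section \<open>Crossed products with coefficients regular at the cusps\<close>

text \<open>The crossed product over the larger coefficient spaces \<^const>\<open>cusp_regular\<close>; it is visibly stable under
  the degenerate action.\<close>

definition regular_crossed :: "crossed set" where
  "regular_crossed = {a. \<forall>k \<gamma>. Poly_Mapping.lookup a (k, \<gamma>) \<in> cusp_regular k}"

lemma crossed_product_regular: "crossed_product \<subseteq> regular_crossed"
  unfolding crossed_product_def regular_crossed_def using modular_forms_cusp_regular by blast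

lemma regular_crossed_zero: "0 \<in> regular_crossed"
  by (simp add: regular_crossed_def cusp_regular_zero)

lemma regular_crossed_add: "a \<in> regular_crossed \<Longrightarrow> b \<in> regular_crossed \<Longrightarrow> a + b \<in> regular_crossed"
  by (simp add: regular_crossed_def lookup_add cusp_regular_add)

lemma regular_crossed_diff: "a \<in> regular_crossed \<Longrightarrow> b \<in> regular_crossed \<Longrightarrow> a - b \<in> regular_crossed"
  by (simp add: regular_crossed_def lookup_minus cusp_regular_diff)

lemma regular_crossed_scale: "a \<in> regular_crossed \<Longrightarrow> crossed_scale c a \<in> regular_crossed"
  by (simp add: regular_crossed_def lookup_crossed_scale cusp_regular_scale)

lemma regular_crossed_single: "f \<in> cusp_regular k \<Longrightarrow> Poly_Mapping.single (k, \<gamma>) f \<in> regular_crossed"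
  by (simp add: regular_crossed_def lookup_single when_def cusp_regular_zero)

text \<open>Removing one term from an element leaves all other coefficients unchanged, so the induction never leaves
  the space.\<close>

lemma regular_crossed_induct [consumes 1, case_names zero single_add]:
  assumes "a \<in> regular_crossed" and zero: "P 0"
    and add: "\<And>k \<gamma> f b. f \<in> cusp_regular k \<Longrightarrow> b \<in> regular_crossed \<Longrightarrow> P b \<Longrightarrow>
      P (Poly_Mapping.single (k, \<gamma>) f + b)"
  shows "P a"
  using assms(1)
proof (induction a rule: update_induct)
  case const
  show ?case by (rule zero)
next
  case (update b x f)
  obtain k \<gamma> where x: "x = (k, \<gamma>)" by (cases x)
  have split: "Poly_Mapping.update x f b = Poly_Mapping.single x f + b"
    using update(1)
    by (intro poly_mapping_eqI)
       (auto simp: lookup_update lookup_add lookup_single in_keys_iff when_def)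
  have reg: "Poly_Mapping.lookup (Poly_Mapping.update x f b) (l, \<beta>) \<in> cusp_regular l" for l \<beta>
    using update.prems by (simp add: regular_crossed_def)
  have "f \<in> cusp_regular k" using reg[of k \<gamma>] by (simp add: lookup_update x)
  moreover have "Poly_Mapping.lookup b (l, \<beta>) \<in> cusp_regular l" for l \<beta>
  proof (cases "(l, \<beta>) = x")
    case True
    then have "Poly_Mapping.lookup b (l, \<beta>) = 0" using update(1) by (simp add: in_keys_iff)
    then show ?thesis by (simp only: cusp_regular_zero)
  next
    case False
    then show ?thesis using reg[of l \<beta>] by (auto simp: lookup_update)
  qed
  then have "b \<in> regular_crossed" by (simp add: regular_crossed_def)
  ultimately show ?case
    unfolding split unfolding x using update(3) by (intro add) auto
qed

lemma regular_crossed_mult: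
  assumes "a \<in> regular_crossed" "b \<in> regular_crossed"
  shows "a \<star> b \<in> regular_crossed"
  using assms(1)
proof (induction a rule: regular_crossed_induct)
  case zero
  show ?case by (simp add: regular_crossed_zero)
next
  case (single_add k \<alpha> f a)
  have "Poly_Mapping.single (k, \<alpha>) f \<star> b \<in> regular_crossed"
    using assms(2)
  proof (induction b rule: regular_crossed_induct)
    case zero
    show ?case by (simp add: regular_crossed_zero)
  next
    case (single_add l \<beta> g b)
    then show ?case
      unfolding crossed_mult_add_right crossed_mult_single
      by (intro regular_crossed_add regular_crossed_single cusp_regular_mult cusp_regular_slash
          \<open>f \<in> cusp_regular k\<close>) auto
  qed
  then show ?case
    unfolding crossed_mult_add_left using single_add by (intro regular_crossed_add)
qed

lemma h1_induct [case_names const gen add mult]: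
  assumes const: "\<And>c. P (h1_const c)" and gen: "\<And>g. P (h1_gen g)"
    and add: "\<And>h k. P h \<Longrightarrow> P k \<Longrightarrow> P (h + k)" and mult: "\<And>h k. P h \<Longrightarrow> P k \<Longrightarrow> P (h * k)"
  shows "P h"
proof -
  have word: "P (abs_h1 (Poly_Mapping.single (Word w) c))" for w c
  proof (induction w)
    case Nil
    have "abs_h1 (Poly_Mapping.single (Word []) c) = h1_const c"
      by (simp add: h1_const.abs_eq pconst_def zero_free_monoid_def)
    then show ?case using const by simp
  next
    case (Cons g w)
    have "abs_h1 (Poly_Mapping.single (Word (g # w)) c) = h1_gen g * abs_h1 (Poly_Mapping.single (Word w) c)"
      by (simp add: h1_gen.abs_eq free_gen_def times_h1.abs_eq mult_single plus_free_monoid_def)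
    then show ?case using mult[OF gen Cons] by simp
  qed
  have "P (abs_h1 p)" for p
  proof (induction p rule: poly_mapping_single_induct)
    case zero
    show ?case using const[of 0] by (simp add: h1_const.abs_eq pconst_def)
  next
    case (single_add w c p)
    then show ?case
      using add[OF word[of "letters w" c] single_add] by (simp add: plus_h1.abs_eq)
  qed
  then show ?thesis by (induction h) auto
qed

lemma degenerate_gen_regular:
  assumes \<omega>: "\<omega> \<in> cusp_regular m" and a: "a \<in> regular_crossed"
  shows "degenerate_gen m \<omega> x a \<in> regular_crossed"
proof -
  have Y: "degenerate_Y m a \<in> regular_crossed" if "a \<in> regular_crossed" for a
    using that unfolding regular_crossed_def mem_Collect_eq lookup_degenerate_Y
    by (intro allI cusp_regular_scale) auto
  have X: "degenerate_X m \<omega> a \<in> regular_crossed" if "a \<in> regular_crossed" for a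
    unfolding degenerate_X_def using that
    by (intro regular_crossed_mult regular_crossed_single \<omega> Y)
  have "degenerate_delta m \<omega> n a \<in> regular_crossed" if "a \<in> regular_crossed" for n a
    using that
  proof (induction n arbitrary: a)
    case 0
    then show ?case
      by (auto intro!: regular_crossed_diff regular_crossed_mult regular_crossed_single \<omega>)
  next
    case (Suc n)
    then show ?case by (auto intro!: regular_crossed_diff X)
  qed
  then show ?thesis using X Y a by (cases x) auto
qed

lemma degenerate_action_regular:
  assumes m: "m > 0" and \<omega>: "\<omega> \<in> cusp_regular m" and "a \<in> regular_crossed"
  shows "degenerate_action m \<omega> h a \<in> regular_crossed"
  using assms(3)
proof (induction h arbitrary: a rule: h1_induct)
  case (const c)
  then show ?case by (simp add: degenerate_action_const m regular_crossed_scale)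
next
  case (gen g)
  then show ?case by (simp add: degenerate_action_gen m degenerate_gen_regular \<omega>)
next
  case (add h k)
  then show ?case by (simp add: degenerate_action_add m regular_crossed_add)
next
  case (mult h k)
  then show ?case by (simp add: degenerate_action_mult m)
qed


section \<open>Biadditive maps\<close>

text \<open>The pairings are additive only on regular arguments, because elsewhere the integrals may diverge.\<close>

definition biadditive :: "(crossed \<Rightarrow> crossed \<Rightarrow> poly2) \<Rightarrow> bool" where
  "biadditive B \<longleftrightarrow>
     (\<forall>a\<in>regular_crossed. \<forall>b\<in>regular_crossed. \<forall>c\<in>regular_crossed.
        B (a + b) c = B a c + B b c \<and> B c (a + b) = B c a + B c b)"

definition regular_additive :: "(crossed \<Rightarrow> crossed) \<Rightarrow> bool" where
  "regular_additive \<phi> \<longleftrightarrow>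
     (\<forall>a\<in>regular_crossed. \<phi> a \<in> regular_crossed \<and> (\<forall>b\<in>regular_crossed. \<phi> (a + b) = \<phi> a + \<phi> b))"

lemma biadditive_compose:
  "biadditive B \<Longrightarrow> regular_additive \<phi> \<Longrightarrow> regular_additive \<psi> \<Longrightarrow> biadditive (\<lambda>a b. B (\<phi> a) (\<psi> b))"
  unfolding biadditive_def regular_additive_def by simp

lemma biadditive_add: "biadditive B \<Longrightarrow> biadditive B' \<Longrightarrow> biadditive (\<lambda>a b. B a b + B' a b)"
  unfolding biadditive_def by (simp add: algebra_simps)

lemma biadditive_mult: "biadditive B \<Longrightarrow> biadditive (\<lambda>a b. p * B a b)"
  unfolding biadditive_def by (simp add: algebra_simps)

lemma biadditive_zero: "biadditive (\<lambda>a b. 0)"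
  by (simp add: biadditive_def)

lemma biadditive_zero_left:
  assumes "biadditive B" "a \<in> regular_crossed"
  shows "B 0 a = 0" and "B a 0 = 0"
proof -
  have "B (0 + 0) a = B 0 a + B 0 a" "B a (0 + 0) = B a 0 + B a 0"
    using assms regular_crossed_zero unfolding biadditive_def by blast+
  then show "B 0 a = 0" "B a 0 = 0" by simp_all
qed

lemma regular_additive_id: "regular_additive (\<lambda>a. a)"
  by (simp add: regular_additive_def)

lemma regular_additive_scale: "regular_additive (crossed_scale c)"
  by (simp add: regular_additive_def regular_crossed_scale module.scale_right_distrib[OF module_crossed])

lemma regular_additive_gen: "\<omega> \<in> cusp_regular m \<Longrightarrow> regular_additive (degenerate_gen m \<omega> x)"
  unfolding regular_additive_def using degenerate_gen_regular degenerate_gen_add by blast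

text \<open>Identities between biadditive expressions need to be checked on homogeneous elements \<open>f U\<^sub>\<alpha>\<close> only.\<close>

lemma biadditive_eqI:
  assumes B: "biadditive B" and B': "biadditive B'"
    and single: "\<And>k \<alpha> f l \<beta> g. f \<in> cusp_regular k \<Longrightarrow> g \<in> cusp_regular l \<Longrightarrow>
      B (Poly_Mapping.single (k, \<alpha>) f) (Poly_Mapping.single (l, \<beta>) g) =
      B' (Poly_Mapping.single (k, \<alpha>) f) (Poly_Mapping.single (l, \<beta>) g)"
    and a: "a \<in> regular_crossed" and b: "b \<in> regular_crossed"
  shows "B a b = B' a b"
  using a
proof (induction a rule: regular_crossed_induct)
  case zero
  show ?case by (simp add: biadditive_zero_left B B' b)
next
  case (single_add k \<alpha> f a)
  note f = regular_crossed_single[OF single_add(1), of \<alpha>]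
  have "B (Poly_Mapping.single (k, \<alpha>) f) b = B' (Poly_Mapping.single (k, \<alpha>) f) b"
    using b
  proof (induction b rule: regular_crossed_induct)
    case zero
    show ?case by (simp add: biadditive_zero_left B B' f)
  next
    case (single_add l \<beta> g b)
    then show ?case
      using B B' f regular_crossed_single[OF single_add(1), of \<beta>] single[OF \<open>f \<in> cusp_regular k\<close> single_add(1), of \<alpha> \<beta>]
      unfolding biadditive_def by simp
  qed
  then show ?case
    using B B' f b single_add unfolding biadditive_def by simp
qed

text \<open>The maps to be extended are additive on regular coefficients only, so additivity is required just for the
  two coefficients that occur at each index.\<close>

lemma pm_extend_add_on:
  assumes zero: "\<And>k. F k 0 = 0"
    and add: "\<And>k. F k (Poly_Mapping.lookup p k + Poly_Mapping.lookup q k) =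
      F k (Poly_Mapping.lookup p k) + F k (Poly_Mapping.lookup q k)"
  shows "pm_extend F (p + q) = pm_extend F p + pm_extend F q"
proof -
  let ?S = "Poly_Mapping.keys p \<union> Poly_Mapping.keys q"
  have "pm_extend F (p + q) = (\<Sum>k\<in>?S. F k (Poly_Mapping.lookup (p + q) k))"
    by (rule pm_extend_superset) (use zero keys_add[of p q] in auto)
  also have "\<dots> = (\<Sum>k\<in>?S. F k (Poly_Mapping.lookup p k)) + (\<Sum>k\<in>?S. F k (Poly_Mapping.lookup q k))"
    by (simp add: lookup_add add sum.distrib)
  also have "\<dots> = pm_extend F p + pm_extend F q"
    by (simp add: pm_extend_superset[of ?S] zero)
  finally show ?thesis .
qed

section \<open>The pairing on the tensor square\<close>

text \<open>The common shape of the two cocycles: \<open>C \<gamma>\<close> stands for the period integral from \<open>z\<^sub>0\<close> to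
  \<open>\<gamma> z\<^sub>0\<close> or for its regularization at the cusps, and the cocycle is \<open>crossed_pairing m C\<close>.\<close>

locale linear_pairing =
  fixes m :: nat and \<omega> :: "complex \<Rightarrow> complex" and C :: "gl2q \<Rightarrow> (complex \<Rightarrow> complex) \<Rightarrow> poly2"
  assumes weight_pos: "m > 0" and \<omega>: "\<omega> \<in> cusp_regular m"
    and lincomb: "\<And>f g c d \<gamma>. f \<in> cusp_regular m \<Longrightarrow> g \<in> cusp_regular m \<Longrightarrow>
      C \<gamma> (\<lambda>z. c * f z + d * g z) = pconst c * C \<gamma> f + pconst d * C \<gamma> g"
begin

abbreviation T :: "crossed \<Rightarrow> crossed \<Rightarrow> poly2" where
  "T \<equiv> crossed_pairing m C"

abbreviation act :: "h1 \<Rightarrow> crossed \<Rightarrow> crossed" where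
  "act \<equiv> degenerate_action m \<omega>"

lemma C_zero: "C \<gamma> 0 = 0"
  using lincomb[OF cusp_regular_zero cusp_regular_zero, of \<gamma> 0 0]
  by (simp add: pconst_def zero_fun_def)

lemma C_add: "f \<in> cusp_regular m \<Longrightarrow> g \<in> cusp_regular m \<Longrightarrow> C \<gamma> (f + g) = C \<gamma> f + C \<gamma> g"
  using lincomb[of f g \<gamma> 1 1] by (simp add: pconst_def plus_fun_def)

lemma C_scale: "f \<in> cusp_regular m \<Longrightarrow> C \<gamma> (\<lambda>z. c * f z) = pconst c * C \<gamma> f"
  using lincomb[of f f \<gamma> c 0] by (simp add: pconst_def)

lemma T_single:
  "T (Poly_Mapping.single (k, \<alpha>) f) (Poly_Mapping.single (l, \<beta>) g) =
     (if k + l = m \<and> \<alpha> * \<beta> = 1 then C \<alpha> (f * slash l g (mat_of \<beta>)) else 0)"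
proof -
  have "pm_extend (\<lambda>(k1, \<gamma>1) f1. if k + k1 = m \<and> \<alpha> * \<gamma>1 = 1 then C \<alpha> (f * slash k1 f1 (mat_of \<gamma>1)) else 0)
      (Poly_Mapping.single (l, \<beta>) g) =
     (if k + l = m \<and> \<alpha> * \<beta> = 1 then C \<alpha> (f * slash l g (mat_of \<beta>)) else 0)" for f
    by (subst pm_extend_single) (auto simp: slash_zero C_zero)
  moreover have "T (Poly_Mapping.single (k, \<alpha>) f) b =
      pm_extend (\<lambda>(k1, \<gamma>1) f1. if k + k1 = m \<and> \<alpha> * \<gamma>1 = 1 then C \<alpha> (f * slash k1 f1 (mat_of \<gamma>1)) else 0) b" for b
    unfolding crossed_pairing_def
    by (subst pm_extend_single) (auto simp: C_zero pm_extend_def split_beta cong: if_cong)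
  ultimately show ?thesis by simp
qed

lemma cusp_regular_pairing:
  "f \<in> cusp_regular k \<Longrightarrow> g \<in> cusp_regular l \<Longrightarrow> k + l = m \<Longrightarrow> f * slash l g (mat_of \<beta>) \<in> cusp_regular m"
  using cusp_regular_mult[OF _ cusp_regular_slash] by blast

lemma T_summand_add:
  assumes "a \<in> regular_crossed" "b \<in> regular_crossed" "c \<in> regular_crossed"
  shows "(if k + l = m \<and> Q then C \<gamma> ((Poly_Mapping.lookup a (k, \<alpha>) + Poly_Mapping.lookup b (k, \<alpha>)) *
        slash l (Poly_Mapping.lookup c (l, \<beta>)) (mat_of \<beta>)) else 0) =
      (if k + l = m \<and> Q then C \<gamma> (Poly_Mapping.lookup a (k, \<alpha>) * slash l (Poly_Mapping.lookup c (l, \<beta>)) (mat_of \<beta>)) else 0) +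
      (if k + l = m \<and> Q then C \<gamma> (Poly_Mapping.lookup b (k, \<alpha>) * slash l (Poly_Mapping.lookup c (l, \<beta>)) (mat_of \<beta>)) else 0)"
    and "(if k + l = m \<and> Q then C \<gamma> (Poly_Mapping.lookup c (k, \<alpha>) *
        slash l (Poly_Mapping.lookup a (l, \<beta>) + Poly_Mapping.lookup b (l, \<beta>)) (mat_of \<beta>)) else 0) =
      (if k + l = m \<and> Q then C \<gamma> (Poly_Mapping.lookup c (k, \<alpha>) * slash l (Poly_Mapping.lookup a (l, \<beta>)) (mat_of \<beta>)) else 0) +
      (if k + l = m \<and> Q then C \<gamma> (Poly_Mapping.lookup c (k, \<alpha>) * slash l (Poly_Mapping.lookup b (l, \<beta>)) (mat_of \<beta>)) else 0)"
proof -
  have reg: "Poly_Mapping.lookup x (k, \<alpha>) * slash l (Poly_Mapping.lookup y (l, \<beta>)) (mat_of \<beta>) \<in> cusp_regular m"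
    if "x \<in> regular_crossed" "y \<in> regular_crossed" "k + l = m" for x y
    using that by (intro cusp_regular_pairing) (simp_all add: regular_crossed_def)
  show "(if k + l = m \<and> Q then C \<gamma> ((Poly_Mapping.lookup a (k, \<alpha>) + Poly_Mapping.lookup b (k, \<alpha>)) *
        slash l (Poly_Mapping.lookup c (l, \<beta>)) (mat_of \<beta>)) else 0) =
      (if k + l = m \<and> Q then C \<gamma> (Poly_Mapping.lookup a (k, \<alpha>) * slash l (Poly_Mapping.lookup c (l, \<beta>)) (mat_of \<beta>)) else 0) +
      (if k + l = m \<and> Q then C \<gamma> (Poly_Mapping.lookup b (k, \<alpha>) * slash l (Poly_Mapping.lookup c (l, \<beta>)) (mat_of \<beta>)) else 0)"
    unfolding distrib_right using C_add[OF reg[OF assms(1,3)] reg[OF assms(2,3)]] by simp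
  show "(if k + l = m \<and> Q then C \<gamma> (Poly_Mapping.lookup c (k, \<alpha>) *
        slash l (Poly_Mapping.lookup a (l, \<beta>) + Poly_Mapping.lookup b (l, \<beta>)) (mat_of \<beta>)) else 0) =
      (if k + l = m \<and> Q then C \<gamma> (Poly_Mapping.lookup c (k, \<alpha>) * slash l (Poly_Mapping.lookup a (l, \<beta>)) (mat_of \<beta>)) else 0) +
      (if k + l = m \<and> Q then C \<gamma> (Poly_Mapping.lookup c (k, \<alpha>) * slash l (Poly_Mapping.lookup b (l, \<beta>)) (mat_of \<beta>)) else 0)"
    unfolding slash_add distrib_left using C_add[OF reg[OF assms(3,1)] reg[OF assms(3,2)]] by simp
qed

lemma biadditive_T: "biadditive T"
  unfolding biadditive_def
proof (intro ballI conjI)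
  fix a b c assume a: "a \<in> regular_crossed" and b: "b \<in> regular_crossed" and c: "c \<in> regular_crossed"
  let ?inner = "\<lambda>k \<alpha> f. \<lambda>(l, \<beta>) g. if k + l = m \<and> \<alpha> * \<beta> = 1 then C \<alpha> (f * slash l g (mat_of \<beta>)) else 0"
  show "T (a + b) c = T a c + T b c"
    unfolding crossed_pairing_def
  proof (rule pm_extend_add_on)
    fix x :: "nat \<times> gl2q"
    obtain k \<alpha> where x: "x = (k, \<alpha>)" by (cases x)
    show "(case x of (k, \<alpha>) \<Rightarrow> \<lambda>f. pm_extend (?inner k \<alpha> f) c) 0 = 0"
      by (simp add: x pm_extend_def split_beta C_zero cong: if_cong)
    show "(case x of (k, \<alpha>) \<Rightarrow> \<lambda>f. pm_extend (?inner k \<alpha> f) c) (Poly_Mapping.lookup a x + Poly_Mapping.lookup b x) =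
        (case x of (k, \<alpha>) \<Rightarrow> \<lambda>f. pm_extend (?inner k \<alpha> f) c) (Poly_Mapping.lookup a x) +
        (case x of (k, \<alpha>) \<Rightarrow> \<lambda>f. pm_extend (?inner k \<alpha> f) c) (Poly_Mapping.lookup b x)"
      unfolding x prod.case pm_extend_def sum.distrib[symmetric]
    proof (rule sum.cong[OF refl])
      fix y :: "nat \<times> gl2q"
      obtain l \<beta> where y: "y = (l, \<beta>)" by (cases y)
      show "?inner k \<alpha> (Poly_Mapping.lookup a (k, \<alpha>) + Poly_Mapping.lookup b (k, \<alpha>)) y (Poly_Mapping.lookup c y) =
          ?inner k \<alpha> (Poly_Mapping.lookup a (k, \<alpha>)) y (Poly_Mapping.lookup c y) +
          ?inner k \<alpha> (Poly_Mapping.lookup b (k, \<alpha>)) y (Poly_Mapping.lookup c y)"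
        unfolding y prod.case by (rule T_summand_add(1)[OF a b c])
    qed
  qed
  have inner: "pm_extend (?inner k \<alpha> (Poly_Mapping.lookup c (k, \<alpha>))) (a + b) =
      pm_extend (?inner k \<alpha> (Poly_Mapping.lookup c (k, \<alpha>))) a + pm_extend (?inner k \<alpha> (Poly_Mapping.lookup c (k, \<alpha>))) b" for k \<alpha>
  proof (rule pm_extend_add_on)
    fix y :: "nat \<times> gl2q"
    obtain l \<beta> where y: "y = (l, \<beta>)" by (cases y)
    show "?inner k \<alpha> (Poly_Mapping.lookup c (k, \<alpha>)) y 0 = 0"
      by (simp add: y slash_zero C_zero)
    show "?inner k \<alpha> (Poly_Mapping.lookup c (k, \<alpha>)) y (Poly_Mapping.lookup a y + Poly_Mapping.lookup b y) =
        ?inner k \<alpha> (Poly_Mapping.lookup c (k, \<alpha>)) y (Poly_Mapping.lookup a y) +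
        ?inner k \<alpha> (Poly_Mapping.lookup c (k, \<alpha>)) y (Poly_Mapping.lookup b y)"
      unfolding y prod.case by (rule T_summand_add(2)[OF a b c])
  qed
  show "T c (a + b) = T c a + T c b"
    unfolding crossed_pairing_def pm_extend_def[of _ c] sum.distrib[symmetric]
  proof (rule sum.cong[OF refl])
    fix x :: "nat \<times> gl2q"
    obtain k \<alpha> where x: "x = (k, \<alpha>)" by (cases x)
    show "(case x of (k, \<alpha>) \<Rightarrow> \<lambda>f. pm_extend (?inner k \<alpha> f) (a + b)) (Poly_Mapping.lookup c x) =
        (case x of (k, \<alpha>) \<Rightarrow> \<lambda>f. pm_extend (?inner k \<alpha> f) a) (Poly_Mapping.lookup c x) +
        (case x of (k, \<alpha>) \<Rightarrow> \<lambda>f. pm_extend (?inner k \<alpha> f) b) (Poly_Mapping.lookup c x)"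
      unfolding x prod.case by (rule inner)
  qed
qed

lemma T_add_left: "a \<in> regular_crossed \<Longrightarrow> b \<in> regular_crossed \<Longrightarrow> c \<in> regular_crossed \<Longrightarrow> T (a + b) c = T a c + T b c"
  and T_add_right: "a \<in> regular_crossed \<Longrightarrow> b \<in> regular_crossed \<Longrightarrow> c \<in> regular_crossed \<Longrightarrow> T c (a + b) = T c a + T c b"
  using biadditive_T unfolding biadditive_def by blast+

lemma T_scale:
  assumes "a \<in> regular_crossed" "b \<in> regular_crossed"
  shows "T (crossed_scale c a) b = pconst c * T a b" "T a (crossed_scale c b) = pconst c * T a b"
proof -
  have l: "(\<lambda>z. c * f z) * g = (\<lambda>z. c * (f * g) z)" and r: "f * (\<lambda>z. c * g z) = (\<lambda>z. c * (f * g) z)"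
    for f g :: "complex \<Rightarrow> complex"
    by (simp_all add: fun_eq_iff)
  show "T (crossed_scale c a) b = pconst c * T a b"
  proof (rule biadditive_eqI[OF biadditive_compose[OF biadditive_T regular_additive_scale regular_additive_id]
          biadditive_mult[OF biadditive_T] _ assms])
    fix k f l g and \<alpha> \<beta> :: gl2q assume f: "f \<in> cusp_regular k" and g: "g \<in> cusp_regular l"
    show "T (crossed_scale c (Poly_Mapping.single (k, \<alpha>) f)) (Poly_Mapping.single (l, \<beta>) g) =
        pconst c * T (Poly_Mapping.single (k, \<alpha>) f) (Poly_Mapping.single (l, \<beta>) g)"
      unfolding crossed_scale_single T_single l using C_scale[OF cusp_regular_pairing[OF f g]] by simp
  qed
  show "T a (crossed_scale c b) = pconst c * T a b"
  proof (rule biadditive_eqI[OF biadditive_compose[OF biadditive_T regular_additive_id regular_additive_scale]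
          biadditive_mult[OF biadditive_T] _ assms])
    fix k f l g and \<alpha> \<beta> :: gl2q assume f: "f \<in> cusp_regular k" and g: "g \<in> cusp_regular l"
    show "T (Poly_Mapping.single (k, \<alpha>) f) (crossed_scale c (Poly_Mapping.single (l, \<beta>) g)) =
        pconst c * T (Poly_Mapping.single (k, \<alpha>) f) (Poly_Mapping.single (l, \<beta>) g)"
      unfolding crossed_scale_single T_single slash_scale r using C_scale[OF cusp_regular_pairing[OF f g]] by simp
  qed
qed

lemma act_regular: "a \<in> regular_crossed \<Longrightarrow> act h a \<in> regular_crossed"
  by (rule degenerate_action_regular[OF weight_pos \<omega>])

lemmas act_simps = degenerate_action_add[OF weight_pos] degenerate_action_mult[OF weight_pos]
  degenerate_action_const[OF weight_pos] degenerate_action_gen[OF weight_pos]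
  module_hom.add[OF degenerate_action_linear[OF weight_pos]]
  module_hom.scale[OF degenerate_action_linear[OF weight_pos]]

lemma act_one: "act 1 a = a"
  using act_simps(3)[of \<omega> 1 a] by (simp add: h1_const_one module.scale_one[OF module_crossed])

text \<open>The value of \<open>T (h\<^sub>1 a) (h\<^sub>2 b)\<close> on a formal combination of pairs \<open>(h\<^sub>1, h\<^sub>2)\<close>. It depends only on
  the class of the combination in \<open>H\<^sub>1 \<otimes> H\<^sub>1\<close>, so that Sweedler sums can be evaluated with
  any representation of the coproduct.\<close>

definition pair_apply :: "(h1_pair \<Rightarrow>\<^sub>0 complex) \<Rightarrow> crossed \<Rightarrow> crossed \<Rightarrow> poly2" where
  "pair_apply p a b = pm_extend (\<lambda>w c. case w of Pr u v \<Rightarrow> pconst c * T (act u a) (act v b)) p"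

lemma pair_apply_zero: "pair_apply 0 a b = 0"
  by (simp add: pair_apply_def)

lemma pair_apply_add: "pair_apply (p + q) a b = pair_apply p a b + pair_apply q a b"
  unfolding pair_apply_def
  by (rule pm_extend_add) (auto simp: pconst_def single_add distrib_right split: h1_pair.split)

lemma pair_apply_diff: "pair_apply (p - q) a b = pair_apply p a b - pair_apply q a b"
  using pair_apply_add[of "p - q" q a b] by simp

lemma pair_apply_single: "pair_apply (Poly_Mapping.single (Pr u v) c) a b = pconst c * T (act u a) (act v b)"
  unfolding pair_apply_def
  by (subst pm_extend_single) (auto simp: pconst_def split: h1_pair.split)

lemma pair_apply_mult_right:
  "pair_apply (p * Poly_Mapping.single (Pr u v) c) a b = pconst c * pair_apply p (act u a) (act v b)"
proof (induction p rule: poly_mapping_single_induct)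
  case zero
  show ?case by (simp add: pair_apply_zero)
next
  case (single_add w d p)
  obtain x y where w: "w = Pr x y" by (cases w)
  show ?case
    unfolding distrib_right pair_apply_add single_add unfolding w mult_single plus_h1_pair.simps
      pair_apply_single act_simps pconst_mult distrib_left
    by (simp only: mult_ac)
qed

text \<open>The pair on the left acts by linear maps, so it carries each bilinearity relation of the arguments of the
  pairing to another one.\<close>

lemma pair_apply_relation:
  assumes "r \<in> tensor_relations" and a: "a \<in> regular_crossed" and b: "b \<in> regular_crossed"
  shows "pair_apply (Poly_Mapping.single (Pr u v) c * r) a b = 0"
  using assms(1)
proof cases
  case (tr_add_left x x' y)
  show ?thesis
    unfolding tr_add_left pair_gen_def right_diff_distrib distrib_left mult_single plus_h1_pair.simps
      pair_apply_diff pair_apply_add pair_apply_single act_simps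
    by (simp add: T_add_left act_regular a b distrib_left)
next
  case (tr_add_right x y y')
  show ?thesis
    unfolding tr_add_right pair_gen_def right_diff_distrib distrib_left mult_single plus_h1_pair.simps
      pair_apply_diff pair_apply_add pair_apply_single act_simps
    by (simp add: T_add_right act_regular a b distrib_left)
next
  case (tr_scale_left d x y)
  show ?thesis
    unfolding tr_scale_left pair_gen_def pconst_def[of d] right_diff_distrib mult_single zero_h1_pair_def
      plus_h1_pair.simps pair_apply_diff pair_apply_single act_simps act_one mult_1_left mult_1_right
    by (simp add: T_scale act_regular a b pconst_mult mult.assoc)
next
  case (tr_scale_right x d y)
  show ?thesis
    unfolding tr_scale_right pair_gen_def pconst_def[of d] right_diff_distrib mult_single zero_h1_pair_def
      plus_h1_pair.simps pair_apply_diff pair_apply_single act_simps act_one mult_1_left mult_1_right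
    by (simp add: T_scale act_regular a b pconst_mult mult.assoc)
qed

text \<open>The ideal is spanned by products \<open>x r y\<close> with a relation \<open>r\<close>. Pairs in \<open>x\<close> preserve relations, and pairs in
  \<open>y\<close> replace the arguments by other regular ones.\<close>

lemma pair_apply_ideal:
  assumes "p \<in> two_sided_ideal tensor_relations" "a \<in> regular_crossed" "b \<in> regular_crossed"
  shows "pair_apply p a b = 0"
  using assms(1)
proof induction
  case ideal_zero
  show ?case by (rule pair_apply_zero)
next
  case (ideal_add p q)
  then show ?case by (simp add: pair_apply_add)
next
  case (ideal_gen r x y)
  have left: "pair_apply (x * r) a b = 0" if "a \<in> regular_crossed" "b \<in> regular_crossed" for a b
  proof (induction x rule: poly_mapping_single_induct)
    case zero
    show ?case by (simp add: pair_apply_zero)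
  next
    case (single_add w c x)
    obtain u v where w: "w = Pr u v" by (cases w)
    show ?case
      unfolding distrib_right pair_apply_add single_add w
      by (simp add: pair_apply_relation ideal_gen that)
  qed
  show ?case
  proof (induction y rule: poly_mapping_single_induct)
    case zero
    show ?case by (simp add: pair_apply_zero)
  next
    case (single_add w c y)
    obtain u v where w: "w = Pr u v" by (cases w)
    show ?case
      unfolding distrib_left pair_apply_add single_add w pair_apply_mult_right
      by (simp add: left act_regular assms(2,3))
  qed
qed

definition tensor_apply :: "h1_tensor \<Rightarrow> crossed \<Rightarrow> crossed \<Rightarrow> poly2" where
  "tensor_apply t = pair_apply (rep_h1_tensor t)"

lemma tensor_apply_abs:
  assumes "a \<in> regular_crossed" "b \<in> regular_crossed"
  shows "tensor_apply (abs_h1_tensor p) a b = pair_apply p a b"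
proof -
  have "ideal_cong tensor_relations (rep_h1_tensor (abs_h1_tensor p)) p"
    by (rule Quotient3_rep_abs[OF Quotient3_h1_tensor]) (rule ideal_cong_refl)
  then have "pair_apply (rep_h1_tensor (abs_h1_tensor p) - p) a b = 0"
    using pair_apply_ideal assms by (simp add: ideal_cong_def)
  then show ?thesis by (simp add: tensor_apply_def pair_apply_diff)
qed

lemma tensor_apply_add:
  assumes "a \<in> regular_crossed" "b \<in> regular_crossed"
  shows "tensor_apply (s + t) a b = tensor_apply s a b + tensor_apply t a b"
  by (induction s; induction t) (simp add: plus_h1_tensor.abs_eq tensor_apply_abs assms pair_apply_add)

lemma tensor_apply_diff:
  assumes "a \<in> regular_crossed" "b \<in> regular_crossed"
  shows "tensor_apply (s - t) a b = tensor_apply s a b - tensor_apply t a b"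
  using tensor_apply_add[OF assms, of "s - t" t] by simp

lemma tensor_apply_pure:
  assumes "a \<in> regular_crossed" "b \<in> regular_crossed"
  shows "tensor_apply (u \<otimes>\<^sub>H v) a b = T (act u a) (act v b)"
  unfolding tensor_abs tensor_apply_abs[OF assms] pair_gen_def pair_apply_single by (simp add: pconst_def)

lemma tensor_apply_const:
  assumes "a \<in> regular_crossed" "b \<in> regular_crossed"
  shows "tensor_apply (tensor_const c) a b = pconst c * T a b"
  unfolding tensor_const.abs_eq tensor_apply_abs[OF assms] pconst_def[of c] zero_h1_pair_def
    pair_apply_single act_one by (simp add: pconst_def)

text \<open>Together with the decomposition of \<open>\<Delta>(k)\<close> into pure tensors, this reduces the invariance under
  \<open>h k\<close> to the invariance under \<open>h\<close>, applied to the arguments already moved by \<open>k\<close>.\<close>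

lemma tensor_apply_mult_pure:
  assumes "a \<in> regular_crossed" "b \<in> regular_crossed"
  shows "tensor_apply (t * (u \<otimes>\<^sub>H v)) a b = tensor_apply t (act u a) (act v b)"
proof -
  define p where "p = rep_h1_tensor t"
  have t: "t = abs_h1_tensor p"
    unfolding p_def by (rule Quotient3_abs_rep[OF Quotient3_h1_tensor, symmetric])
  show ?thesis
    unfolding t tensor_abs times_h1_tensor.abs_eq tensor_apply_abs[OF assms]
      tensor_apply_abs[OF act_regular[OF assms(1)] act_regular[OF assms(2)]] pair_gen_def pair_apply_mult_right
    by (simp add: pconst_def)
qed

lemma tensor_apply_sum:
  assumes "a \<in> regular_crossed" "b \<in> regular_crossed"
  shows "tensor_apply (\<Sum>i<(n::nat). t i) a b = (\<Sum>i<n. tensor_apply (t i) a b)"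
proof (induction n)
  case 0
  show ?case using tensor_apply_add[OF assms, of 0 0] by simp
qed (simp add: tensor_apply_add[OF assms])


section \<open>Invariance\<close>

definition invariant :: "h1 \<Rightarrow> bool" where
  "invariant h \<longleftrightarrow> (\<forall>a\<in>regular_crossed. \<forall>b\<in>regular_crossed.
     tensor_apply (coproduct h) a b = pconst (character h) * T a b)"

lemma invariant_const: "invariant (h1_const c)"
  by (simp add: invariant_def coproduct_const character_const tensor_apply_const)

lemma invariant_add: "invariant h \<Longrightarrow> invariant k \<Longrightarrow> invariant (h + k)"
  by (simp add: invariant_def coproduct_add character_add tensor_apply_add pconst_add distrib_right)

lemma invariant_diff:
  assumes "invariant h" "invariant k"
  shows "invariant (h - k)"
proof -
  have "coproduct (h - k) = coproduct h - coproduct k"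
    using coproduct_add[of "h - k" k] by (simp add: algebra_simps)
  moreover have "character h = character (h - k) + character k"
    using character_add[of "h - k" k] by simp
  ultimately show ?thesis
    using assms by (simp add: invariant_def tensor_apply_diff pconst_add distrib_right)
qed

lemma invariant_mult:
  assumes h: "invariant h" and k: "invariant k"
  shows "invariant (h * k)"
  unfolding invariant_def
proof (intro ballI)
  fix a b assume ab: "a \<in> regular_crossed" "b \<in> regular_crossed"
  obtain n :: nat and u v where t: "coproduct k = (\<Sum>i<n. u i \<otimes>\<^sub>H v i)"
    using ex_sum_pure_tensors by blast
  have "tensor_apply (coproduct (h * k)) a b = (\<Sum>i<n. tensor_apply (coproduct h * (u i \<otimes>\<^sub>H v i)) a b)"
    unfolding coproduct_mult t sum_distrib_left tensor_apply_sum[OF ab] ..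
  also have "\<dots> = (\<Sum>i<n. pconst (character h) * tensor_apply (u i \<otimes>\<^sub>H v i) a b)"
    using h by (simp add: tensor_apply_mult_pure tensor_apply_pure ab act_regular invariant_def)
  also have "\<dots> = pconst (character h) * tensor_apply (coproduct k) a b"
    unfolding t sum_distrib_left[symmetric] tensor_apply_sum[OF ab] ..
  also have "\<dots> = pconst (character (h * k)) * T a b"
    using k ab by (simp add: invariant_def character_mult pconst_mult mult.assoc)
  finally show "tensor_apply (coproduct (h * k)) a b = pconst (character (h * k)) * T a b" .
qed

lemmas additive_gen = regular_additive_gen[OF \<omega>]

text \<open>The operator \<open>Y\<close> multiplies by weight over \<open>m\<close>, and the pairing vanishes unless the two weights add up
  to \<open>m\<close>.\<close>

lemma invariant_Y: "invariant (h1_gen genY)"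
  unfolding invariant_def coproduct_gen character_gen
proof (intro ballI)
  fix a b assume ab: "a \<in> regular_crossed" "b \<in> regular_crossed"
  have "T (degenerate_gen m \<omega> genY a) b + T a (degenerate_gen m \<omega> genY b) = T a b"
  proof (rule biadditive_eqI[OF biadditive_add[OF
        biadditive_compose[OF biadditive_T additive_gen regular_additive_id]
        biadditive_compose[OF biadditive_T regular_additive_id additive_gen]] biadditive_T _ ab])
    fix k f l g and \<alpha> \<beta> :: gl2q assume f: "f \<in> cusp_regular k" and g: "g \<in> cusp_regular l"
    let ?a = "Poly_Mapping.single (k, \<alpha>) f" and ?b = "Poly_Mapping.single (l, \<beta>) g"
    have scale: "degenerate_gen m \<omega> genY (Poly_Mapping.single (j, \<gamma>) f) =
        crossed_scale (of_nat j / of_nat m) (Poly_Mapping.single (j, \<gamma>) f)" for j \<gamma> f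
      by (simp add: degenerate_Y_single crossed_scale_single)
    have "T (degenerate_gen m \<omega> genY ?a) ?b + T ?a (degenerate_gen m \<omega> genY ?b) =
        pconst (of_nat k / of_nat m + of_nat l / of_nat m) * T ?a ?b"
      unfolding scale T_scale[OF regular_crossed_single[OF f] regular_crossed_single[OF g]] pconst_add
      by (rule distrib_right[symmetric])
    also have "\<dots> = T ?a ?b"
    proof (cases "k + l = m")
      case True
      \<comment> \<open>The two weight fractions add up to 1 exactly in the case where the pairing can be nonzero.\<close>
      have "of_nat k / of_nat m + of_nat l / of_nat m = (1 :: complex)"
        using weight_pos by (simp flip: True of_nat_add add_divide_distrib)
      then show ?thesis by (simp add: pconst_def)
    qed (simp add: T_single)
    finally show "T (degenerate_gen m \<omega> genY ?a) ?b + T ?a (degenerate_gen m \<omega> genY ?b) = T ?a ?b" .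
  qed
  then show "tensor_apply (coproduct_gen genY) a b = pconst 1 * T a b"
    by (simp add: tensor_apply_add tensor_apply_pure ab act_one act_simps pconst_def)
qed

text \<open>All three terms raise the total weight by \<open>m\<close>. Hence they can contribute only for arguments of
  weight 0, and each of them contains a factor \<open>Y\<close>, which kills weight 0.\<close>

lemma invariant_X: "invariant (h1_gen genX)"
  unfolding invariant_def coproduct_gen character_gen
proof (intro ballI)
  fix a b assume ab: "a \<in> regular_crossed" "b \<in> regular_crossed"
  have "T (degenerate_gen m \<omega> genX a) b + T a (degenerate_gen m \<omega> genX b) +
      T (degenerate_gen m \<omega> (genD 0) a) (degenerate_gen m \<omega> genY b) = 0"
  proof (rule biadditive_eqI[OF biadditive_add[OF biadditive_add[OF
        biadditive_compose[OF biadditive_T additive_gen regular_additive_id]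
        biadditive_compose[OF biadditive_T regular_additive_id additive_gen]]
        biadditive_compose[OF biadditive_T additive_gen additive_gen]] biadditive_zero _ ab])
    fix k f l g and \<alpha> \<beta> :: gl2q assume f: "f \<in> cusp_regular k" and g: "g \<in> cusp_regular l"
    let ?a = "Poly_Mapping.single (k, \<alpha>) f" and ?b = "Poly_Mapping.single (l, \<beta>) g"
    have zero: "(\<lambda>z. 0 :: complex) = 0" by (simp add: zero_fun_def)
    have "T (degenerate_gen m \<omega> genX ?a) ?b = 0"
      by (auto simp: degenerate_X_single T_single zero C_zero)
    moreover have "T ?a (degenerate_gen m \<omega> genX ?b) = 0"
      by (auto simp: degenerate_X_single T_single zero C_zero slash_zero)
    moreover have "T (degenerate_gen m \<omega> (genD 0) ?a) (degenerate_gen m \<omega> genY ?b) = 0"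
      unfolding degenerate_gen.simps degenerate_delta_single[OF weight_pos] degenerate_Y_single T_single
      by (auto simp: zero C_zero slash_zero)
    ultimately show "T (degenerate_gen m \<omega> genX ?a) ?b + T ?a (degenerate_gen m \<omega> genX ?b) +
      T (degenerate_gen m \<omega> (genD 0) ?a) (degenerate_gen m \<omega> genY ?b) = 0" by simp
  qed
  then show "tensor_apply (coproduct_gen genX) a b = pconst 0 * T a b"
    by (simp add: coproduct_X_def tensor_apply_add tensor_apply_pure ab act_one act_simps pconst_def)
qed

text \<open>In total weight \<open>m\<close> both arguments have weight 0, and \<open>\<beta> = \<alpha>\<^sup>-\<^sup>1\<close>. The two integrands are then
  \<open>(\<omega> - \<omega>|\<beta>) f (g|\<beta>)\<close> and \<open>f ((\<omega> - \<omega>|\<alpha>) g)|\<beta> = f (\<omega>|\<beta> - \<omega>) (g|\<beta>)\<close>, with sum zero.\<close>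

lemma T_delta_cancel:
  assumes f: "f \<in> cusp_regular k" and g: "g \<in> cusp_regular l"
  shows "T (degenerate_gen m \<omega> (genD 0) (Poly_Mapping.single (k, \<alpha>) f)) (Poly_Mapping.single (l, \<beta>) g) +
    T (Poly_Mapping.single (k, \<alpha>) f) (degenerate_gen m \<omega> (genD 0) (Poly_Mapping.single (l, \<beta>) g)) = 0"
proof -
  have delta: "degenerate_gen m \<omega> (genD 0) (Poly_Mapping.single (j, \<gamma>) h) =
      Poly_Mapping.single (m + j, \<gamma>) ((\<omega> - slash m \<omega> (mat_of (gl2q_inv \<gamma>))) * h)" for j \<gamma> h
    unfolding degenerate_gen.simps degenerate_delta_single[OF weight_pos]
    by (simp add: add.commute times_fun_def fun_diff_def)
  show ?thesis
  proof (cases "k = 0 \<and> l = 0 \<and> \<alpha> * \<beta> = 1")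
    case False
    then show ?thesis using weight_pos unfolding delta T_single by auto
  next
    case True
    then have kl: "k = 0" "l = 0" and \<alpha>\<beta>: "\<alpha> * \<beta> = 1" by auto
    have "gl2q_inv \<alpha> * (\<alpha> * \<beta>) = \<beta>" by (simp only: mult.assoc[symmetric] gl2q_inv mult_1_left)
    then have inv\<alpha>: "gl2q_inv \<alpha> = \<beta>" by (simp only: \<alpha>\<beta> mult_1_right)
    have "(\<alpha> * \<beta>) * gl2q_inv \<beta> = \<alpha>" by (simp only: mult.assoc gl2q_inv mult_1_right)
    then have inv\<beta>: "gl2q_inv \<beta> = \<alpha>" by (simp only: \<alpha>\<beta> mult_1_left)
    let ?\<omega>\<alpha> = "slash m \<omega> (mat_of \<alpha>)" and ?\<omega>\<beta> = "slash m \<omega> (mat_of \<beta>)"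
    let ?F = "((\<omega> - ?\<omega>\<beta>) * f) * slash 0 g (mat_of \<beta>)"
    let ?G = "f * slash m ((\<omega> - ?\<omega>\<alpha>) * g) (mat_of \<beta>)"
    have reg: "?F \<in> cusp_regular m" "?G \<in> cusp_regular m"
    proof -
      have fg: "f \<in> cusp_regular 0" "g \<in> cusp_regular 0" using f g kl by simp_all
      have "?F \<in> cusp_regular ((m + 0) + 0)"
        by (intro cusp_regular_mult cusp_regular_diff cusp_regular_slash \<omega> fg)
      then show "?F \<in> cusp_regular m" by simp
      have "(\<omega> - ?\<omega>\<alpha>) * g \<in> cusp_regular (m + 0)"
        by (intro cusp_regular_mult cusp_regular_diff cusp_regular_slash \<omega> fg)
      then have "?G \<in> cusp_regular (0 + m)"
        by (intro cusp_regular_mult cusp_regular_slash fg) simp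
      then show "?G \<in> cusp_regular m" by simp
    qed
    have "?F + ?G = 0"
    proof
      fix z
      \<comment> \<open>Composition of slashes is available in the upper half-plane only; below it \<open>f\<close> vanishes.\<close>
      show "(?F + ?G) z = 0 z"
      proof (cases "Im z > 0")
        case False
        then have "f z = 0" using f by (simp add: cusp_regular_def)
        then show ?thesis by simp
      next
        case True
        have "slash m ?\<omega>\<alpha> (mat_of \<beta>) z = slash m \<omega> (mat_of (\<alpha> * \<beta>)) z"
          using True by (simp add: slash_slash det_mat_of times_gl2q.rep_eq)
        then have comp: "slash m ?\<omega>\<alpha> (mat_of \<beta>) z = \<omega> z" by (simp add: \<alpha>\<beta> slash_one)
        have diff: "slash m (\<omega> - ?\<omega>\<alpha>) (mat_of \<beta>) = ?\<omega>\<beta> - slash m ?\<omega>\<alpha> (mat_of \<beta>)"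
          using slash_lincomb[of m 1 \<omega> "-1" ?\<omega>\<alpha> "mat_of \<beta>"] by (simp add: fun_diff_def)
        have mult: "slash m ((\<omega> - ?\<omega>\<alpha>) * g) (mat_of \<beta>) = slash m (\<omega> - ?\<omega>\<alpha>) (mat_of \<beta>) * slash 0 g (mat_of \<beta>)"
          using slash_mult[OF det_mat_of, of m 0 "\<omega> - ?\<omega>\<alpha>" g \<beta>] by simp
        have "?G z = f z * ((?\<omega>\<beta> z - \<omega> z) * slash 0 g (mat_of \<beta>) z)"
          by (simp add: mult diff comp)
        then show ?thesis by (simp add: algebra_simps)
      qed
    qed
    then show ?thesis
      unfolding delta T_single inv\<alpha> inv\<beta> using C_add[OF reg, of \<alpha>] C_zero \<alpha>\<beta> by (simp add: kl)
  qed
qed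

lemma invariant_delta_1: "invariant (h1_gen (genD 0))"
  unfolding invariant_def coproduct_gen character_gen
proof (intro ballI)
  fix a b assume ab: "a \<in> regular_crossed" "b \<in> regular_crossed"
  have "T (degenerate_gen m \<omega> (genD 0) a) b + T a (degenerate_gen m \<omega> (genD 0) b) = 0"
    by (rule biadditive_eqI[OF biadditive_add[OF
        biadditive_compose[OF biadditive_T additive_gen regular_additive_id]
        biadditive_compose[OF biadditive_T regular_additive_id additive_gen]] biadditive_zero _ ab])
       (rule T_delta_cancel)
  then show "tensor_apply (coproduct_gen (genD 0)) a b = pconst 0 * T a b"
    by (simp add: tensor_apply_add tensor_apply_pure ab act_one act_simps pconst_def
        del: degenerate_gen.simps)
qed

text \<open>The elements \<open>\<delta>\<^sub>n\<close> are iterated commutators of \<open>X\<close> with \<open>\<delta>\<^sub>1\<close>.\<close>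

lemma invariant_delta: "invariant (h1_gen (genD n))"
proof (induction n)
  case 0
  show ?case by (rule invariant_delta_1)
next
  case (Suc n)
  show ?case
    unfolding h1_rel_XD[symmetric] commutator_def
    by (intro invariant_diff invariant_mult invariant_X Suc)
qed

theorem invariance: "invariant h"
proof (induction h rule: h1_induct)
  case (gen g)
  show ?case by (cases g) (simp_all add: invariant_X invariant_Y invariant_delta)
qed (simp_all add: invariant_const invariant_add invariant_mult)

lemma sweedler_invariance:
  fixes n :: nat
  assumes "a \<in> regular_crossed" "b \<in> regular_crossed" "coproduct h = (\<Sum>i<n. u i \<otimes>\<^sub>H v i)"
  shows "(\<Sum>i<n. T (act (u i) a) (act (v i) b)) = pconst (character h) * T a b"
  using invariance[of h] assms by (simp add: invariant_def tensor_apply_sum tensor_apply_pure)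

end

theorem lemma8:
  fixes m n :: nat and \<omega> :: "complex \<Rightarrow> complex" and z0 :: complex
    and h :: h1 and h' h'' :: "nat \<Rightarrow> h1" and a0 a1 :: crossed
  assumes "m \<ge> 2" and "\<omega> \<in> modular_forms m" and "Im z0 > 0"
    and "a0 \<in> crossed_product" and "a1 \<in> crossed_product"
    and "coproduct h = (\<Sum>i<n. h' i \<otimes>\<^sub>H h'' i)"
  shows "(\<Sum>i<n. tau m z0 (degenerate_action m \<omega> (h' i) a0) (degenerate_action m \<omega> (h'' i) a1)) =
           pconst (character h) * tau m z0 a0 a1 \<and>
         (\<Sum>i<n. tau_tilde m z0 (degenerate_action m \<omega> (h' i) a0) (degenerate_action m \<omega> (h'' i) a1)) =
           pconst (character h) * tau_tilde m z0 a0 a1"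
proof -
  have \<omega>: "m > 0" "\<omega> \<in> cusp_regular m" using assms(1,2) modular_forms_cusp_regular by auto
  have a: "a0 \<in> regular_crossed" "a1 \<in> regular_crossed"
    using assms(4,5) crossed_product_regular by auto
  interpret periods: linear_pairing m \<omega> "tau_term m z0"
    by unfold_locales (use \<omega> tau_term_lincomb assms(3) in auto)
  interpret regularized: linear_pairing m \<omega> "tau_tilde_term m z0"
    by unfold_locales (use \<omega> tau_tilde_term_lincomb assms(3) in auto)
  show ?thesis
    unfolding tau_def tau_tilde_def
    using periods.sweedler_invariance[OF a assms(6)] regularized.sweedler_invariance[OF a assms(6)] ..
qed

end
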